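(* Let $n\ge1$ be an integer, $\alpha=2$ and $\nu>0$. For every integer $N\ge1$, as $r\to\infty$, $$q_{2,\nu,n}(r)=\frac{e^{-r}}{2^{\frac{n-1}{2}+\nu}\pi^{\frac{n-1}{2}}\Gamma(\nu)}\sum_{j=0}^{N-1}\frac{1}{2^jj!}\frac{\Gamma\left(\frac{n+1}{2}+j-\nu\right)}{\Gamma\left(\frac{n+1}{2}-j-\nu\right)}r^{\nu-\frac{n+1}{2}-j}+O\left(r^{\nu-\frac{n+1}{2}-N}e^{-r}\right).$$ In particular, the leading term as $r\to\infty$ is $$q_{2,\nu,n}(r)\sim\frac{r^{\nu-\frac{n+1}{2}}e^{-r}}{2^{\frac{n-1}{2}+\nu}\pi^{\frac{n-1}{2}}\Gamma(\nu)}.$$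
   Context: $\Vert\cdot\Vert$ is the Euclidean norm on $\mathbb{R}^n$. For an integer $n\ge1$, $\alpha\in(0,2]$, $\nu>0$, $p_{\alpha,\nu,n}$ denotes the probability density function on $\mathbb{R}^n$ whose characteristic function is $\int_{\mathbb{R}^n}e^{i\mathbf{x}\cdot\boldsymbol{t}}p_{\alpha,\nu,n}(\mathbf{x})\,d^n\mathbf{x}=(1+\Vert\boldsymbol{t}\Vert^\alpha)^{-\nu}$ for all $\boldsymbol{t}\in\mathbb{R}^n$. It is a radial function; one takes the version which is continuous on $\mathbb{R}^n\setminus\{\mathbf{0}\}$, and $q_{\alpha,\nu,n}(r)$, $r>0$, denotes the value of $p_{\alpha,\nu,n}(\mathbf{x})$ at points with $\Vert\mathbf{x}\Vert=r$. Convention: for real $a$ and integer $j\ge0$, the quotient $\Gamma(a+j)/\Gamma(a-j)$ is understood as the product $\prod_{i=-j}^{j-1}(a+i)$ (equal to $1$ for $j=0$), which is its value by continuity when $a$ is such that the gamma functions have poles. $f\sim g$ means $f/g\to1$. *)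

theory Defs
  imports "HOL-Probability.Probability"
begin

definition is_linnik_pdf :: "real \<Rightarrow> real \<Rightarrow> (real ^ 'n::finite \<Rightarrow> real) \<Rightarrow> bool" where
  "is_linnik_pdf \<alpha> \<nu> p \<longleftrightarrow>
     p \<in> borel_measurable borel \<and>
     (\<forall>x. 0 \<le> p x) \<and>
     prob_space (density lborel (\<lambda>x. ennreal (p x))) \<and>
     (\<forall>t. (CLINT x|lborel. iexp (x \<bullet> t) * complex_of_real (p x))
            = complex_of_real ((1 + norm t powr \<alpha>) powr (- \<nu>))) \<and>
     continuous_on (- {0}) p"

text \<open>The density is determined by its characteristic function up to a null set, hence, by
  continuity, everywhere except at the origin. So the choice below affects its value at 0 only.\<close>

definition linnik_pdf :: "real \<Rightarrow> real \<Rightarrow> real ^ 'n::finite \<Rightarrow> real" where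
  "linnik_pdf \<alpha> \<nu> = (SOME p. is_linnik_pdf \<alpha> \<nu> p)"

text \<open>The radial profile, meaningful for positive \<open>r\<close>: the common value of the density at all points
  of norm \<open>r\<close>. The first argument only carries the dimension.\<close>

definition linnik_radial :: "'n::finite itself \<Rightarrow> real \<Rightarrow> real \<Rightarrow> real \<Rightarrow> real" where
  "linnik_radial _ \<alpha> \<nu> r =
     (THE y. \<forall>x :: real ^ 'n. norm x = r \<longrightarrow> linnik_pdf \<alpha> \<nu> x = y)"

text \<open>The quotient \<open>Gamma (a + j) / Gamma (a - j)\<close>, extended by continuity to those \<open>a\<close> where the
  Gamma functions have poles. (In the library, Gamma is 0 at its poles, so the literal quotient
  would be wrong there.)\<close>

definition Gamma_quotient :: "real \<Rightarrow> nat \<Rightarrow> real" where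
  "Gamma_quotient a j = (\<Prod>i = - int j..int j - 1. a + real_of_int i)"

end

theory Submission
  imports Defs
begin

text \<open>
  The density is a mixture of centred Gaussians whose variance parameter is Gamma-distributed,
  because averaging \<open>exp (- s * norm t ^ 2)\<close> over the Gamma distribution of \<open>s\<close> gives
  \<open>(1 + norm t ^ 2) powr (- \<nu>)\<close>; convolution with narrow Gaussians shows that a Fourier transform
  determines the function at its points of continuity. The mixture is an integral of Bessel \<open>K\<close>
  type with parameter \<open>a = (n + 1) / 2 - \<nu>\<close>. For \<open>a > 0\<close>, Tonelli's theorem turns it into a multiple of the
  integral of \<open>exp (- r * x) * (x\<^sup>2 - 1) powr (a - 1)\<close> over \<open>x > 1\<close>, and expanding the
  binomial \<open>(1 + v / 2) powr (a - 1)\<close> after \<open>x = 1 + v\<close> gives the asymptotic series term by term.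
  The case \<open>a \<le> 0\<close> follows from the symmetry \<open>a \<mapsto> 1 - a\<close> of both the integral and the
  coefficients.
\<close>

subsection \<open>Gaussians and Fourier uniqueness\<close>

text \<open>\<open>linnik_pdf\<close> is an arbitrary choice and \<open>linnik_radial\<close> a
  definite description, so no formula is available before pointwise uniqueness off the origin is
  known; uniqueness almost everywhere alone would not fix the value on a sphere, which is a null
  set. The split at \<open>a = 0\<close> is forced by the integral over \<open>x > 1\<close>: for
  \<open>a \<le> 0\<close>, that is \<open>\<nu> \<ge> (n + 1) / 2\<close>, its integrand is not
  integrable at \<open>x = 1\<close>, whereas the Bessel integral converges for every order.
  Reflection replaces the order \<open>1 / 2 - a\<close> by \<open>1 / 2 - (1 - a)\<close>, and then
  \<open>1 - a \<ge> 1\<close>. The integral identities behind the Bessel representation are stated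
  in \<open>ennreal\<close>: an equation with a finite right-hand side yields convergence together
  with the value, and exchanging two integrals takes only measurability.\<close>

lemma lborel_integral_prod_Basis:
  fixes f :: "'a::euclidean_space \<Rightarrow> real \<Rightarrow> 'b::{real_normed_field,banach,second_countable_topology}"
  assumes f: "\<And>b. b \<in> Basis \<Longrightarrow> integrable lborel (f b)"
  shows "integrable lborel (\<lambda>x::'a. \<Prod>b\<in>Basis. f b (x \<bullet> b))"
    and "(\<integral>x. (\<Prod>b\<in>Basis. f b (x \<bullet> b)) \<partial>lborel) = (\<Prod>b\<in>Basis. integral\<^sup>L lborel (f b))"
proof -
  interpret product_sigma_finite "\<lambda>b::'a. lborel :: real measure" ..
  have [measurable]: "f b \<in> borel_measurable borel" if "b \<in> Basis" for b
    using borel_measurable_integrable[OF f[OF that]] by simp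
  have coord: "(\<Prod>b\<in>Basis. f b ((\<Sum>c\<in>Basis. x c *\<^sub>R c) \<bullet> b)) = (\<Prod>b\<in>Basis. f b (x b))" for x :: "'a \<Rightarrow> real"
    by (intro prod.cong refl) (simp add: inner_sum_left inner_Basis if_distrib cong: if_cong)
  have meas: "(\<lambda>x::'a. \<Prod>b\<in>Basis. f b (x \<bullet> b)) \<in> borel_measurable borel"
    by measurable
  have emb: "(\<lambda>x. \<Sum>b\<in>Basis. x b *\<^sub>R b) \<in> measurable (\<Pi>\<^sub>M b\<in>(Basis::'a set). lborel) borel"
    by measurable
  show "integrable lborel (\<lambda>x::'a. \<Prod>b\<in>Basis. f b (x \<bullet> b))"
    unfolding lborel_eq[where 'a='a] integrable_distr_eq[OF emb meas] coord
    by (rule product_integrable_prod) (auto intro: f)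
  show "(\<integral>x. (\<Prod>b\<in>Basis. f b (x \<bullet> b)) \<partial>lborel) = (\<Prod>b\<in>Basis. integral\<^sup>L lborel (f b))"
    unfolding lborel_eq[where 'a='a] integral_distr[OF emb meas] coord
    by (rule product_integral_prod) (auto intro: f)
qed

text \<open>The heat kernel at time \<open>s\<close>: a centred Gaussian with variance
  \<open>2 * s\<close> in every coordinate. With this parameter the exponent of its Fourier
  transform is linear in \<open>s\<close>, so mixing over \<open>s\<close> becomes a Laplace
  transform.\<close>

definition gaussian :: "real \<Rightarrow> 'a::euclidean_space \<Rightarrow> real" where
  "gaussian s x = (4 * pi * s) powr (- (real DIM('a) / 2)) * exp (- (norm x)\<^sup>2 / (4 * s))"

lemma gaussian_nonneg [simp]: "0 \<le> gaussian s x"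
  by (simp add: gaussian_def)

lemma borel_measurable_gaussian [measurable]: "gaussian s \<in> borel_measurable borel"
  unfolding gaussian_def by measurable

lemma gaussian_fourier_real:
  fixes t :: real
  assumes s: "s > 0"
  shows "integrable lborel (\<lambda>x. iexp (x * t) * complex_of_real (normal_density 0 (sqrt (2 * s)) x))"
    and "(CLINT x|lborel. iexp (x * t) * complex_of_real (normal_density 0 (sqrt (2 * s)) x))
          = exp (- s * t\<^sup>2)"
proof -
  let ?\<sigma> = "sqrt (2 * s)"
  have int: "integrable lborel (normal_density 0 ?\<sigma>)"
    using s by (intro integrable_normal_density) simp
  show "integrable lborel (\<lambda>x. iexp (x * t) * complex_of_real (normal_density 0 ?\<sigma> x))"
    by (rule Bochner_Integration.integrable_bound[OF int])
       (auto simp: norm_mult)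
  have "(CLINT x|lborel. iexp (x * t) * complex_of_real (normal_density 0 ?\<sigma> x))
      = ?\<sigma> *\<^sub>R (CLINT x|lborel. iexp ((0 + ?\<sigma> * x) * t) * complex_of_real (normal_density 0 ?\<sigma> (0 + ?\<sigma> * x)))"
    using s by (subst lborel_integral_real_affine[where c="?\<sigma>" and t=0]) auto
  also have "\<dots> = (CLINT x|lborel. std_normal_density x *\<^sub>R iexp (t * ?\<sigma> * x))"
  proof -
    have "?\<sigma> * normal_density 0 ?\<sigma> (?\<sigma> * x) = std_normal_density x" for x
      using s by (simp add: normal_density_def power_mult_distrib real_sqrt_mult field_simps)
    then have "?\<sigma> *\<^sub>R (iexp ((0 + ?\<sigma> * x) * t) * complex_of_real (normal_density 0 ?\<sigma> (0 + ?\<sigma> * x)))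
        = std_normal_density x *\<^sub>R iexp (t * ?\<sigma> * x)" for x
      by (simp add: scaleR_conv_of_real mult_ac flip: of_real_mult)
    then show ?thesis
      by (subst integral_scaleR_right[symmetric]) (rule Bochner_Integration.integral_cong, simp_all)
  qed
  also have "\<dots> = char std_normal_distribution (t * ?\<sigma>)"
    unfolding char_def by (subst integral_density) auto
  also have "\<dots> = exp (- s * t\<^sup>2)"
    using s by (simp add: char_std_normal_distribution power_mult_distrib)
  finally show "(CLINT x|lborel. iexp (x * t) * complex_of_real (normal_density 0 ?\<sigma> x))
          = exp (- s * t\<^sup>2)" .
qed

text \<open>Character and Gaussian both factor over an orthonormal basis, so the one-dimensional
  transforms are multiplied over the coordinates.\<close>

lemma gaussian_fourier:
  fixes t :: "'a::euclidean_space"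
  assumes s: "s > 0"
  shows "integrable lborel (\<lambda>x. iexp (x \<bullet> t) * complex_of_real (gaussian s x))" (is ?A)
    and "(CLINT x|lborel. iexp (x \<bullet> t) * complex_of_real (gaussian s x)) = exp (- s * (norm t)\<^sup>2)" (is ?B)
proof -
  let ?f = "\<lambda>b x. iexp (x * (t \<bullet> b)) * complex_of_real (normal_density 0 (sqrt (2 * s)) x)"
  have norm2: "(\<Sum>b\<in>Basis. (x \<bullet> b)\<^sup>2) = (norm x)\<^sup>2" for x :: 'a
    unfolding power2_norm_eq_inner by (subst euclidean_inner) (simp add: power2_eq_square)
  have eq: "(\<Prod>b\<in>Basis. ?f b (x \<bullet> b)) = iexp (x \<bullet> t) * complex_of_real (gaussian s x)" for x :: 'a
  proof -
    have "(\<Prod>b\<in>(Basis::'a set). iexp ((x \<bullet> b) * (t \<bullet> b))) = iexp (x \<bullet> t)"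
      by (subst exp_sum[symmetric]) (auto simp: euclidean_inner[of x t] sum_distrib_left)
    moreover have "(\<Prod>b\<in>(Basis::'a set). normal_density 0 (sqrt (2 * s)) (x \<bullet> b)) = gaussian s x"
    proof -
      have "(\<Prod>b\<in>(Basis::'a set). normal_density 0 (sqrt (2 * s)) (x \<bullet> b))
          = (1 / sqrt (4 * pi * s)) ^ DIM('a) * exp (\<Sum>b\<in>(Basis::'a set). - (x \<bullet> b)\<^sup>2 / (4 * s))"
        using s by (simp add: normal_density_def prod.distrib exp_sum prod_dividef prod_constant mult.assoc power_one_over)
      also have "(1 / sqrt (4 * pi * s)) ^ DIM('a) = (4 * pi * s) powr (- (real DIM('a) / 2))"
      proof -
        have "1 / sqrt (4 * pi * s) = (4 * pi * s) powr (- (1 / 2))"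
          using s by (simp add: powr_minus_divide powr_half_sqrt)
        then show ?thesis
          using s by (simp add: powr_power)
      qed
      also have "(\<Sum>b\<in>(Basis::'a set). - (x \<bullet> b)\<^sup>2 / (4 * s)) = - (norm x)\<^sup>2 / (4 * s)"
        by (simp only: sum_divide_distrib[symmetric] sum_negf norm2)
      finally show ?thesis by (simp add: gaussian_def)
    qed
    ultimately show ?thesis
      by (simp only: prod.distrib of_real_prod[symmetric])
  qed
  have int: "integrable lborel (?f b)" for b
    by (rule gaussian_fourier_real(1)[OF s])
  show ?A
    using lborel_integral_prod_Basis(1)[of ?f, OF int] unfolding eq .
  have "(CLINT x|lborel. iexp (x \<bullet> t) * complex_of_real (gaussian s x)) =
      (\<Prod>b\<in>(Basis::'a set). complex_of_real (exp (- s * (t \<bullet> b)\<^sup>2)))"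
    using lborel_integral_prod_Basis(2)[of ?f, OF int] unfolding eq gaussian_fourier_real(2)[OF s] .
  also have "\<dots> = exp (\<Sum>b\<in>(Basis::'a set). - s * (t \<bullet> b)\<^sup>2)"
    by (simp add: exp_sum)
  also have "(\<Sum>b\<in>(Basis::'a set). - s * (t \<bullet> b)\<^sup>2) = - s * (norm t)\<^sup>2"
    by (simp only: sum_distrib_left[symmetric] norm2)
  finally show ?B .
qed

lemma integrable_gaussian: "s > 0 \<Longrightarrow> integrable lborel (gaussian s :: 'a::euclidean_space \<Rightarrow> real)"
  using integrable_norm[OF gaussian_fourier(1)[of s "0::'a"]] by simp

lemma integral_gaussian:
  "s > 0 \<Longrightarrow> (\<integral>x. gaussian s (x::'a::euclidean_space) \<partial>lborel) = 1"
  using gaussian_fourier(2)[of s "0::'a"] by (simp del: of_real_eq_1_iff add: of_real_eq_1_iff[where 'a=complex])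

lemma nn_integral_gaussian:
  "s > 0 \<Longrightarrow> (\<integral>\<^sup>+x. gaussian s (x::'a::euclidean_space) \<partial>lborel) = 1"
  by (subst nn_integral_eq_integral) (auto simp: integrable_gaussian integral_gaussian)

text \<open>The weight is itself the transform of \<open>gaussian s\<close> at \<open>y - x\<close>.
  Inserting this and exchanging the integrals leaves the transform of \<open>d\<close> at
  \<open>- t\<close> inside, which vanishes. Fubini applies because the modulus of
  \<open>F x t\<close> is the product \<open>\<bar>d x\<bar> * gaussian s t\<close>.\<close>

lemma fourier_transform_zero_imp_gauss_mean_zero:
  fixes d :: "'a::euclidean_space \<Rightarrow> real"
  assumes d: "integrable lborel d"
    and FT: "\<And>t. (CLINT x|lborel. iexp (x \<bullet> t) * complex_of_real (d x)) = 0"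
    and s: "s > 0"
  shows "(\<integral>x. d x * exp (- s * (norm (y - x))\<^sup>2) \<partial>lborel) = 0"
proof -
  define F where "F = (\<lambda>x t :: 'a. complex_of_real (d x) * (iexp (t \<bullet> (y - x)) * complex_of_real (gaussian s t)))"
  have [measurable]: "d \<in> borel_measurable borel"
    using borel_measurable_integrable[OF d] by simp
  have norm_F: "norm (F x t) = \<bar>d x\<bar> * gaussian s t" for x t
    by (simp add: F_def norm_mult)
  have int_x: "integrable lborel (F x)" for x
    unfolding F_def by (intro integrable_mult_right gaussian_fourier s)
  have int: "integrable (lborel \<Otimes>\<^sub>M lborel) (case_prod F)"
  proof (rule lborel_pair.Fubini_integrable)
    show "case_prod F \<in> borel_measurable (lborel \<Otimes>\<^sub>M lborel)"
      unfolding F_def by measurable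
    show "integrable lborel (\<lambda>x. \<integral>t. norm (case_prod F (x, t)) \<partial>lborel)"
      using d s by (simp add: norm_F integral_gaussian)
    show "AE x in lborel. integrable lborel (\<lambda>t. case_prod F (x, t))"
      using int_x by simp
  qed
  have "complex_of_real (\<integral>x. d x * exp (- s * (norm (y - x))\<^sup>2) \<partial>lborel)
      = (CLINT x|lborel. complex_of_real (d x) * (CLINT t|lborel. iexp (t \<bullet> (y - x)) * complex_of_real (gaussian s t)))"
    by (subst gaussian_fourier(2)[OF s]) (simp flip: of_real_mult integral_complex_of_real)
  also have "\<dots> = (CLINT x|lborel. (CLINT t|lborel. F x t))"
    unfolding F_def by simp
  also have "\<dots> = (CLINT t|lborel. (CLINT x|lborel. F x t))"
    by (rule lborel_pair.Fubini_integral[OF int, symmetric])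
  also have "\<dots> = (CLINT t|lborel. iexp (t \<bullet> y) * complex_of_real (gaussian s t)
      * (CLINT x|lborel. iexp (x \<bullet> (- t)) * complex_of_real (d x)))"
  proof -
    have "F x t = iexp (t \<bullet> y) * complex_of_real (gaussian s t)
        * (iexp (x \<bullet> (- t)) * complex_of_real (d x))" for x t
      unfolding F_def
      by (simp add: inner_diff_right inner_commute[of x t] right_diff_distrib exp_diff exp_minus divide_inverse)
    then show ?thesis
      by (simp only: integral_mult_right_zero)
  qed
  also have "\<dots> = 0"
    unfolding FT by simp
  finally show ?thesis
    by (simp only: of_real_eq_0_iff)
qed

text \<open>If \<open>d y\<close> were positive, a narrow Gaussian weight centred at \<open>y\<close> would give \<open>d\<close> a positive mean:
  on a small ball the weight is exponentially larger than away from \<open>y\<close>.\<close>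

lemma fourier_transform_zero_imp_nonpos:
  fixes d :: "'a::euclidean_space \<Rightarrow> real"
  assumes d: "integrable lborel d"
    and FT: "\<And>t. (CLINT x|lborel. iexp (x \<bullet> t) * complex_of_real (d x)) = 0"
    and cont: "isCont d y"
  shows "d y \<le> 0"
proof (rule ccontr)
  assume "\<not> d y \<le> 0"
  then have pos: "d y > 0" by simp
  have [measurable]: "d \<in> borel_measurable borel"
    using borel_measurable_integrable[OF d] by simp
  obtain \<delta> where \<delta>: "\<delta> > 0" and near: "\<And>x. dist x y < \<delta> \<Longrightarrow> dist (d x) (d y) < d y / 2"
    using cont pos unfolding continuous_at_eps_delta
    by (metis half_gt_zero_iff)
  have lower: "d x \<ge> d y / 2" if "dist x y < \<delta>" for x
    using near[OF that] by (auto simp: dist_real_def abs_real_def split: if_splits)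
  define V where "V = measure lborel (ball y (\<delta> / 2))"
  have V: "V > 0"
    unfolding V_def using content_ball_pos[of "\<delta> / 2" y] \<delta> by simp
  define D where "D = (\<integral>x. \<bar>d x\<bar> \<partial>lborel)"
  have bound: "d y / 2 * V * exp (- s * (\<delta> / 2)\<^sup>2) \<le> D * exp (- s * \<delta>\<^sup>2)" if s: "s > 0" for s
  proof -
    let ?w = "\<lambda>x. exp (- s * (norm (y - x))\<^sup>2)"
    let ?I = "indicator (ball y (\<delta> / 2)) :: 'a \<Rightarrow> real"
    have w1: "?w x \<le> 1" for x using s by simp
    have int1: "integrable lborel (\<lambda>x. d x * ?w x)"
      by (rule Bochner_Integration.integrable_bound[OF d])
         (use w1 in \<open>auto simp: abs_mult mult_left_le\<close>)
    have int2: "integrable lborel (\<lambda>x. \<bar>d x\<bar> * exp (- s * \<delta>\<^sup>2))"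
      using d by simp
    have int3: "integrable lborel (\<lambda>x. d y / 2 * exp (- s * (\<delta> / 2)\<^sup>2) * ?I x)"
      by (intro integrable_mult_right integrable_real_indicator emeasure_bounded_finite) auto
    have "d y / 2 * exp (- s * (\<delta> / 2)\<^sup>2) * ?I x \<le> d x * ?w x + \<bar>d x\<bar> * exp (- s * \<delta>\<^sup>2)" for x
    proof (cases "dist x y < \<delta>")
      case True
      have "d y / 2 * exp (- s * (\<delta> / 2)\<^sup>2) * ?I x \<le> d x * ?w x"
      proof (cases "x \<in> ball y (\<delta> / 2)")
        case True
        then have "(norm (y - x))\<^sup>2 \<le> (\<delta> / 2)\<^sup>2"
          by (intro power_mono) (auto simp: dist_norm)
        then have "exp (- s * (\<delta> / 2)\<^sup>2) \<le> ?w x"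
          using s by simp
        then have "d y / 2 * exp (- s * (\<delta> / 2)\<^sup>2) \<le> d x * ?w x"
          using lower[OF \<open>dist x y < \<delta>\<close>] pos by (intro mult_mono) auto
        then show ?thesis
          using True by simp
      next
        case False
        then show ?thesis
          using lower[OF \<open>dist x y < \<delta>\<close>] pos by simp
      qed
      then show ?thesis
        by (simp add: add_increasing2)
    next
      case False
      then have "\<delta>\<^sup>2 \<le> (norm (y - x))\<^sup>2"
        using \<delta> by (intro power_mono) (auto simp: dist_norm norm_minus_commute)
      then have "?w x \<le> exp (- s * \<delta>\<^sup>2)"
        using s by simp
      then have "\<bar>d x * ?w x\<bar> \<le> \<bar>d x\<bar> * exp (- s * \<delta>\<^sup>2)"
        by (simp add: abs_mult mult_left_mono)
      moreover have "?I x = 0"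
        using False \<delta> by (auto simp: indicator_def dist_commute)
      ultimately show ?thesis
        by simp
    qed
    then have "(\<integral>x. d y / 2 * exp (- s * (\<delta> / 2)\<^sup>2) * ?I x \<partial>lborel)
        \<le> (\<integral>x. d x * ?w x + \<bar>d x\<bar> * exp (- s * \<delta>\<^sup>2) \<partial>lborel)"
      by (intro integral_mono int3 Bochner_Integration.integrable_add int1 int2)
    also have "\<dots> = D * exp (- s * \<delta>\<^sup>2)"
      unfolding Bochner_Integration.integral_add[OF int1 int2]
        fourier_transform_zero_imp_gauss_mean_zero[OF d FT s]
      by (simp add: D_def)
    finally show ?thesis
      by (simp add: V_def mult_ac)
  qed
  have "D \<ge> 0"
    unfolding D_def by simp
  define E where "E = d y / 2 * V"
  have E: "E > 0"
    using pos V by (simp add: E_def)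
  \<comment> \<open>The gap between the two exponents is \<open>\<delta>\<^sup>2 - (\<delta> /
    2)\<^sup>2 = 3 / 4 * \<delta>\<^sup>2\<close>. This \<open>s\<close> makes \<open>s\<close>
    times the gap equal to \<open>D / E + 1\<close>, whose exponential exceeds \<open>D / E\<close>;
    the summand 1 also keeps \<open>s\<close> positive if \<open>D = 0\<close>.\<close>
  define s where "s = (D / E + 1) / (3 / 4 * \<delta>\<^sup>2)"
  have s: "s > 0"
    unfolding s_def using \<open>D \<ge> 0\<close> E \<delta> by (intro divide_pos_pos add_nonneg_pos) auto
  have "D / E < exp (s * (3 / 4 * \<delta>\<^sup>2))"
  proof -
    have "s * (3 / 4 * \<delta>\<^sup>2) = D / E + 1"
      unfolding s_def using \<delta> by (subst times_divide_eq_left, intro nonzero_mult_div_cancel_right) auto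
    then show ?thesis
      using exp_ge_add_one_self[of "D / E + 1"] by (simp only:)
  qed
  then have small: "D * exp (- s * (3 / 4 * \<delta>\<^sup>2)) < E"
    using E by (simp add: exp_minus field_simps)
  have "D * exp (- s * \<delta>\<^sup>2) = D * exp (- s * (3 / 4 * \<delta>\<^sup>2)) * exp (- s * (\<delta> / 2)\<^sup>2)"
    by (simp add: mult.assoc power_divide flip: exp_add)
  also have "\<dots> < E * exp (- s * (\<delta> / 2)\<^sup>2)"
    using small by simp
  finally show False
    using bound[OF s] by (simp add: E_def)
qed

text \<open>The one-sided bound is applied to \<open>p - q\<close> and to \<open>q - p\<close>.
  Continuity enters at the single point \<open>y\<close>, which suits densities that may be singular
  at the origin.\<close>

lemma fourier_transform_inj_continuity_point:
  fixes p q :: "'a::euclidean_space \<Rightarrow> real"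
  assumes p: "integrable lborel p" and q: "integrable lborel q"
    and eq: "\<And>t. (CLINT x|lborel. iexp (x \<bullet> t) * complex_of_real (p x))
                = (CLINT x|lborel. iexp (x \<bullet> t) * complex_of_real (q x))"
    and cont: "isCont p y" "isCont q y"
  shows "p y = q y"
proof -
  have *: "f y - g y \<le> 0"
    if f: "integrable lborel f" and g: "integrable lborel g" and "isCont f y" "isCont g y"
      and eq: "\<And>t. (CLINT x|lborel. iexp (x \<bullet> t) * complex_of_real (f x))
                = (CLINT x|lborel. iexp (x \<bullet> t) * complex_of_real (g x))"
    for f g :: "'a \<Rightarrow> real"
  proof (rule fourier_transform_zero_imp_nonpos[where d="\<lambda>x. f x - g x"])
    have int: "integrable lborel (\<lambda>x. iexp (x \<bullet> t) * complex_of_real (h x))"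
      if "integrable lborel h" for h :: "'a \<Rightarrow> real" and t
      by (rule Bochner_Integration.integrable_bound[OF that])
         (use borel_measurable_integrable[OF that] in \<open>auto simp: norm_mult\<close>)
    show "(CLINT x|lborel. iexp (x \<bullet> t) * complex_of_real (f x - g x)) = 0" for t
      using Bochner_Integration.integral_diff[OF int[OF f] int[OF g]] eq
      by (simp add: right_diff_distrib)
  qed (use that in auto)
  show ?thesis
    using *[of p q] *[of q p] assms by auto
qed

subsection \<open>Integral representations\<close>

text \<open>A bridge between two integrals: the library's substitution rule speaks of absolute
  integrability and \<open>integral\<close>, the calculations below of nonnegative integrals over
  \<open>lborel\<close>. Pairing integrability with a value \<open>b\<close> matches the form of
  that rule.\<close>

lemma absolutely_integrable_on_iff_nn_integral:
  fixes h :: "real \<Rightarrow> real"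
  assumes [measurable]: "S \<in> sets borel" "h \<in> borel_measurable borel"
    and nonneg: "\<And>x. x \<in> S \<Longrightarrow> 0 \<le> h x"
  shows "h absolutely_integrable_on S \<and> integral S h = b \<longleftrightarrow>
    0 \<le> b \<and> (\<integral>\<^sup>+x. ennreal (indicator S x * h x) \<partial>lborel) = ennreal b"
proof -
  have meas: "(\<lambda>x. indicator S x * h x) \<in> borel_measurable lborel"
    by measurable
  have nn: "0 \<le> indicator S x * h x" for x
    using nonneg by (auto simp: indicator_def)
  have int_eq: "integral S h = (\<integral>x. indicator S x * h x \<partial>lborel)" if "h absolutely_integrable_on S"
    using set_lebesgue_integral_eq_integral(2)[OF that] integral_completion[OF meas]
    by (simp add: set_lebesgue_integral_def)
  have abs_iff: "h absolutely_integrable_on S \<longleftrightarrow> integrable lborel (\<lambda>x. indicator S x * h x)"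
    by (simp add: set_integrable_def integrable_completion)
  show ?thesis
  proof
    assume *: "h absolutely_integrable_on S \<and> integral S h = b"
    then have "b = (\<integral>x. indicator S x * h x \<partial>lborel)"
      using int_eq by simp
    with * show "0 \<le> b \<and> (\<integral>\<^sup>+x. ennreal (indicator S x * h x) \<partial>lborel) = ennreal b"
      using nn abs_iff by (auto intro: nn_integral_eq_integral)
  next
    assume *: "0 \<le> b \<and> (\<integral>\<^sup>+x. ennreal (indicator S x * h x) \<partial>lborel) = ennreal b"
    then have "integrable lborel (\<lambda>x. indicator S x * h x)"
      using nn by (intro integrableI_nn_integral_finite[of _ _ b]) auto
    moreover have "(\<integral>x. indicator S x * h x \<partial>lborel) = b"
      using * nn by (subst integral_eq_nn_integral) auto
    ultimately show "h absolutely_integrable_on S \<and> integral S h = b"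
      using int_eq abs_iff by auto
  qed
qed

lemma nn_integral_change_of_variables_real:
  fixes f g g' :: "real \<Rightarrow> real"
  assumes [measurable]: "S \<in> sets borel" "T \<in> sets borel" "f \<in> borel_measurable borel"
      "g \<in> borel_measurable borel" "g' \<in> borel_measurable borel"
    and T: "g ` S = T"
    and der: "\<And>x. x \<in> S \<Longrightarrow> (g has_real_derivative g' x) (at x)"
    and inj: "inj_on g S"
    and nonneg: "\<And>y. y \<in> T \<Longrightarrow> 0 \<le> f y"
  shows "(\<integral>\<^sup>+y. ennreal (indicator T y * f y) \<partial>lborel)
       = (\<integral>\<^sup>+x. ennreal (indicator S x * (\<bar>g' x\<bar> * f (g x))) \<partial>lborel)" (is "?A = ?B")
proof -
  have iff: "0 \<le> b \<and> ?B = ennreal b \<longleftrightarrow> 0 \<le> b \<and> ?A = ennreal b" for b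
  proof -
    have "(\<lambda>x. \<bar>g' x\<bar> * f (g x)) absolutely_integrable_on S \<and> integral S (\<lambda>x. \<bar>g' x\<bar> * f (g x)) = b
        \<longleftrightarrow> f absolutely_integrable_on T \<and> integral T f = b"
      unfolding T[symmetric]
      by (rule has_absolute_integral_change_of_variables_1')
         (auto intro: has_field_derivative_at_within der inj)
    then show ?thesis
      using nonneg T by (subst (asm) (1 2) absolutely_integrable_on_iff_nn_integral) auto
  qed
  \<comment> \<open>By \<open>iff\<close> the two sides attain the same finite values, so an
    infinite value of one excludes a finite value of the other.\<close>
  show ?thesis
  proof (cases ?A)
    case (real b)
    then show ?thesis using iff[of b] by simp
  next
    case top
    then show ?thesis
      by (cases ?B) (use iff in auto)
  qed
qed

lemma ennreal_mult_eq_imp_eq_divide: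
  assumes eq: "ennreal k * J = ennreal v" and k: "k > 0" and v: "v \<ge> 0"
  shows "J = ennreal (v / k)"
proof -
  have "J = ennreal (1 / k * k) * J"
    using k by simp
  also have "\<dots> = ennreal (1 / k) * (ennreal k * J)"
    using k by (subst ennreal_mult) (auto simp: mult.assoc)
  also have "\<dots> = ennreal (v / k)"
    unfolding eq using k v by (simp flip: ennreal_mult)
  finally show ?thesis .
qed

lemma nn_integral_Gamma_scaled:
  assumes a: "a > (0::real)" and c: "c > 0"
  shows "(\<integral>\<^sup>+v. ennreal (indicator {0<..} v * (v powr (a - 1) * exp (- c * v))) \<partial>lborel) = Gamma a * c powr (- a)"
proof -
  have "ennreal (Gamma a) = (\<integral>\<^sup>+y. ennreal (indicator {0<..} y * (y powr (a - 1) * exp (- y))) \<partial>lborel)"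
    unfolding Gamma_conv_nn_integral_real[OF a]
    by (rule nn_integral_cong) (auto simp: indicator_def exp_minus divide_inverse)
  also have "\<dots> = (\<integral>\<^sup>+v. ennreal (indicator {0<..} v * (\<bar>c\<bar> * ((c * v) powr (a - 1) * exp (- (c * v))))) \<partial>lborel)"
    using c
  proof (intro nn_integral_change_of_variables_real)
    show "(*) c ` {0<..} = {0<..}"
    proof safe
      fix y :: real assume "y > 0"
      then show "y \<in> (*) c ` {0<..}"
        using c by (intro image_eqI[of _ _ "y / c"]) auto
    qed (use c in auto)
  qed (auto intro!: derivative_eq_intros inj_onI)
  also have "\<dots> = (\<integral>\<^sup>+v. ennreal (c powr a) * ennreal (indicator {0<..} v * (v powr (a - 1) * exp (- c * v))) \<partial>lborel)"
    using c by (intro nn_integral_cong)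
       (auto simp: indicator_def powr_mult powr_diff simp flip: ennreal_mult)
  also have "\<dots> = ennreal (c powr a) * (\<integral>\<^sup>+v. ennreal (indicator {0<..} v * (v powr (a - 1) * exp (- c * v))) \<partial>lborel)"
    by (rule nn_integral_cmult) measurable
  finally have *: "ennreal (Gamma a) = ennreal (c powr a) * (\<integral>\<^sup>+v. ennreal (indicator {0<..} v * (v powr (a - 1) * exp (- c * v))) \<partial>lborel)" .
  show ?thesis
    using ennreal_mult_eq_imp_eq_divide[OF *[symmetric]] a c by (simp add: powr_minus divide_inverse)
qed

text \<open>Up to elementary factors this is the modified Bessel function of the second kind of order \<open>p\<close>
  at \<open>2 * sqrt (b * c)\<close>.\<close>

definition bessel_nn :: "real \<Rightarrow> real \<Rightarrow> real \<Rightarrow> ennreal" where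
  "bessel_nn p b c = (\<integral>\<^sup>+s. ennreal (indicator {0<..} s * (s powr (p - 1) * exp (- (b * s) - c / s))) \<partial>lborel)"

text \<open>The substitution \<open>s \<mapsto> c / (b * s)\<close> exchanges the two terms of the
  exponent. Classically, \<open>bessel_nn p b c\<close> is \<open>2 * (c / b) powr (p / 2)\<close>
  times the Bessel function of order \<open>p\<close> at \<open>2 * sqrt (b * c)\<close>, so this is
  the evenness of that function in its order.\<close>

lemma bessel_nn_reflect:
  assumes b: "b > 0" and c: "c > 0"
  shows "bessel_nn p b c = ennreal ((c / b) powr p) * bessel_nn (- p) b c"
proof -
  have "bessel_nn p b c = (\<integral>\<^sup>+s. ennreal (indicator {0<..} s * (\<bar>- c / (b * s\<^sup>2)\<bar> *
      ((c / (b * s)) powr (p - 1) * exp (- (b * (c / (b * s))) - c / (c / (b * s)))))) \<partial>lborel)"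
    unfolding bessel_nn_def
  proof (rule nn_integral_change_of_variables_real)
    show "(\<lambda>s. c / (b * s)) ` {0<..} = {0<..}"
    proof safe
      fix y :: real assume "y > 0"
      then show "y \<in> (\<lambda>s. c / (b * s)) ` {0<..}"
        using b c by (intro image_eqI[of _ _ "c / (b * y)"]) auto
    qed (use b c in auto)
    show "((\<lambda>s. c / (b * s)) has_real_derivative - c / (b * x\<^sup>2)) (at x)" if "x \<in> {0<..}" for x
      using that b by (auto intro!: derivative_eq_intros simp: power2_eq_square field_simps)
    show "inj_on (\<lambda>s. c / (b * s)) {0<..}"
      using b c by (auto intro!: inj_onI simp: field_simps)
  qed auto
  also have "\<dots> = (\<integral>\<^sup>+s. ennreal ((c / b) powr p) * ennreal (indicator {0<..} s * (s powr (- p - 1) * exp (- (b * s) - c / s))) \<partial>lborel)"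
  proof (intro nn_integral_cong)
    fix s :: real
    have "c / (b * s\<^sup>2) * ((c / (b * s)) powr (p - 1)) = (c / b) powr p * s powr (- p - 1)" if "s > 0"
    proof -
      have e1: "c / (b * s\<^sup>2) = (c / b) powr 1 * s powr (- 2)"
        using that b c by (simp add: powr_minus field_simps)
      have e2: "(c / (b * s)) powr (p - 1) = (c / b) powr (p - 1) * s powr (- (p - 1))"
        using that b c
        by (simp add: powr_divide powr_mult field_simps) (simp flip: powr_add)
      have e3: "(c / b) powr 1 * (c / b) powr (p - 1) = (c / b) powr p"
        "s powr (- 2) * s powr (- (p - 1)) = s powr (- p - 1)"
        unfolding powr_add[symmetric] by (rule arg_cong2[where f="(powr)"], simp_all)+
      have "c / (b * s\<^sup>2) * ((c / (b * s)) powr (p - 1))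
          = ((c / b) powr 1 * (c / b) powr (p - 1)) * (s powr (- 2) * s powr (- (p - 1)))"
        unfolding e1 e2 by (simp only: mult_ac)
      then show ?thesis
        unfolding e3 .
    qed
    moreover have "- (b * (c / (b * s))) - c / (c / (b * s)) = - (b * s) - c / s" if "s > 0"
      using that b c by (simp add: field_simps)
    ultimately show "ennreal (indicator {0<..} s * (\<bar>- c / (b * s\<^sup>2)\<bar> *
      ((c / (b * s)) powr (p - 1) * exp (- (b * (c / (b * s))) - c / (c / (b * s)))))) =
      ennreal ((c / b) powr p) * ennreal (indicator {0<..} s * (s powr (- p - 1) * exp (- (b * s) - c / s)))"
      using b c by (cases "s > 0") (simp_all add: mult.assoc[symmetric] flip: ennreal_mult)
  qed
  also have "\<dots> = ennreal ((c / b) powr p) * bessel_nn (- p) b c"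
    unfolding bessel_nn_def by (rule nn_integral_cmult) measurable
  finally show ?thesis .
qed

text \<open>The substitution \<open>y = sqrt (b * s) - sqrt (c / s)\<close> completes the square in the exponent.\<close>

lemma bessel_nn_half:
  assumes b: "b > 0" and c: "c > 0"
  shows "bessel_nn (1 / 2) b c = ennreal (sqrt (pi / b) * exp (- 2 * sqrt (b * c)))"
proof -
  define g where "g = (\<lambda>s. sqrt b * sqrt s - sqrt c / sqrt s)"
  define g' where "g' = (\<lambda>s. (sqrt b * s powr (- (1 / 2)) + sqrt c * s powr (- (3 / 2))) / 2)"
  have [measurable]: "g \<in> borel_measurable borel" "g' \<in> borel_measurable borel"
    unfolding g_def g'_def by measurable
  \<comment> \<open>The Gaussian integral is the starting point: \<open>gaussian (1/4) y\<close> is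
    \<open>exp (- y\<^sup>2)\<close> divided by \<open>sqrt pi\<close>. It is then pulled back along
    \<open>g\<close>.\<close>
  have "ennreal (pi powr (1/2)) = ennreal (pi powr (1/2)) * (\<integral>\<^sup>+y. gaussian (1/4) (y::real) \<partial>lborel)"
    by (simp add: nn_integral_gaussian)
  also have "\<dots> = (\<integral>\<^sup>+y. ennreal (pi powr (1/2)) * gaussian (1/4) (y::real) \<partial>lborel)"
    by (rule nn_integral_cmult[symmetric]) measurable
  also have "\<dots> = (\<integral>\<^sup>+y. ennreal (indicator UNIV y * exp (- y\<^sup>2)) \<partial>lborel)"
    by (intro nn_integral_cong)
       (simp add: gaussian_def mult.assoc[symmetric] flip: ennreal_mult powr_add)
  also have "\<dots> = (\<integral>\<^sup>+s. ennreal (indicator {0<..} s * (\<bar>g' s\<bar> * exp (- (g s)\<^sup>2))) \<partial>lborel)"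
  proof (rule nn_integral_change_of_variables_real)
    have "strict_mono_on {0<..} g"
    proof (rule strict_mono_onI)
      fix x y :: real assume "x \<in> {0<..}" "y \<in> {0<..}" "x < y"
      then show "g x < g y"
        unfolding g_def using b c by (intro diff_strict_mono divide_strict_left_mono) auto
    qed
    then show "inj_on g {0<..}"
      by (rule strict_mono_on_imp_inj_on)
    show "g ` {0<..} = UNIV"
    proof safe
      fix y :: real
      \<comment> \<open>\<open>w\<close> plays the role of \<open>sqrt s\<close>: it is the positive
        root of \<open>sqrt b * w\<^sup>2 - y * w - sqrt c = 0\<close>, which is
        \<open>g (w\<^sup>2) = y\<close> cleared of denominators.\<close>
      define w where "w = (y + sqrt (y\<^sup>2 + 4 * sqrt b * sqrt c)) / (2 * sqrt b)"
      have "\<bar>y\<bar> < sqrt (y\<^sup>2 + 4 * sqrt b * sqrt c)"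
        using b c by (intro real_less_rsqrt) auto
      then have w: "w > 0"
        using b by (simp add: w_def)
      have "(2 * sqrt b * w - y)\<^sup>2 = y\<^sup>2 + 4 * sqrt b * sqrt c"
        using b c by (simp add: w_def)
      then have "4 * sqrt b * (sqrt b * w\<^sup>2 - y * w - sqrt c) = 0"
        by (simp add: power2_eq_square algebra_simps)
      then have "sqrt b * w\<^sup>2 - sqrt c = y * w"
        using b by simp
      then have "g (w\<^sup>2) = y"
        using w by (simp add: g_def field_simps power2_eq_square)
      then show "y \<in> g ` {0<..}"
        using w by (intro image_eqI[of _ _ "w\<^sup>2"]) auto
    qed auto
    show "(g has_real_derivative g' x) (at x)" if "x \<in> {0<..}" for x
    proof -
      have x: "x > 0" using that by simp
      have *: "x powr (- (1 / 2)) = inverse (sqrt x)" "x powr (- (3 / 2)) = inverse (sqrt x) / x"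
      proof -
        show half: "x powr (- (1 / 2)) = inverse (sqrt x)"
          using x by (simp add: powr_minus powr_half_sqrt)
        have one: "x powr (- 1) = inverse x"
          using x powr_minus[of x 1] by simp
        have split: "- (3 / 2) = - (1 / 2) + (- 1 :: real)"
          by simp
        show "x powr (- (3 / 2)) = inverse (sqrt x) / x"
          by (subst split, subst powr_add, subst half, subst one) (rule divide_inverse[symmetric])
      qed
      have "(g has_real_derivative sqrt b * (inverse (sqrt x) / 2)
          - (0 * sqrt x - sqrt c * (inverse (sqrt x) / 2)) / (sqrt x * sqrt x)) (at x)"
        unfolding g_def by (intro DERIV_diff DERIV_cmult DERIV_divide DERIV_const DERIV_real_sqrt) (use x in auto)
      moreover have "sqrt b * (inverse (sqrt x) / 2)
          - (0 * sqrt x - sqrt c * (inverse (sqrt x) / 2)) / (sqrt x * sqrt x) = g' x"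
        unfolding g'_def * using x by (simp add: add_divide_distrib)
      ultimately show ?thesis
        by simp
    qed
  qed auto
  also have "\<dots> = (\<integral>\<^sup>+s. ennreal (exp (2 * sqrt (b * c)) / 2) *
      (ennreal (sqrt b) * ennreal (indicator {0<..} s * (s powr (1 / 2 - 1) * exp (- (b * s) - c / s)))
     + ennreal (sqrt c) * ennreal (indicator {0<..} s * (s powr (- (1 / 2) - 1) * exp (- (b * s) - c / s)))) \<partial>lborel)"
  proof (intro nn_integral_cong)
    fix s :: real
    show "ennreal (indicator {0<..} s * (\<bar>g' s\<bar> * exp (- (g s)\<^sup>2))) =
      ennreal (exp (2 * sqrt (b * c)) / 2) *
      (ennreal (sqrt b) * ennreal (indicator {0<..} s * (s powr (1 / 2 - 1) * exp (- (b * s) - c / s)))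
     + ennreal (sqrt c) * ennreal (indicator {0<..} s * (s powr (- (1 / 2) - 1) * exp (- (b * s) - c / s))))"
    proof (cases "s > 0")
      case True
      have sq: "- (g s)\<^sup>2 = 2 * sqrt (b * c) + (- (b * s) - c / s)"
        using True b c by (simp add: g_def power2_diff power_mult_distrib power_divide real_sqrt_mult)
      have e: "exp (- (g s)\<^sup>2) = exp (2 * sqrt (b * c)) * exp (- (b * s) - c / s)"
        unfolding sq by (rule exp_add)
      have "\<bar>g' s\<bar> = g' s"
        using b c by (simp add: g'_def)
      then show ?thesis
        using True b c unfolding e g'_def
        by (simp add: algebra_simps flip: ennreal_mult ennreal_plus)
    qed simp
  qed
  also have "\<dots> = ennreal (exp (2 * sqrt (b * c)) / 2) *
      (ennreal (sqrt b) * bessel_nn (1 / 2) b c + ennreal (sqrt c) * bessel_nn (- (1 / 2)) b c)"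
    unfolding bessel_nn_def by (subst nn_integral_cmult nn_integral_add; measurable?)+ simp?
  \<comment> \<open>The two terms of \<open>g'\<close> have produced the orders \<open>1 / 2\<close>
    and \<open>- (1 / 2)\<close>. Reflection makes their contributions equal, so a single unknown
    remains and can be solved for.\<close>
  also have "ennreal (sqrt c) * bessel_nn (- (1 / 2)) b c = ennreal (sqrt b) * bessel_nn (1 / 2) b c"
  proof -
    have "sqrt c * (c / b) powr (- (1 / 2)) = sqrt b"
      using b c by (simp add: powr_minus powr_half_sqrt real_sqrt_divide)
    then show ?thesis
      using bessel_nn_reflect[OF b c, of "- (1 / 2)"] c
      by (simp add: mult.assoc[symmetric] flip: ennreal_mult)
  qed
  also have "ennreal (exp (2 * sqrt (b * c)) / 2) *
      (ennreal (sqrt b) * bessel_nn (1 / 2) b c + ennreal (sqrt b) * bessel_nn (1 / 2) b c)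
      = ennreal (exp (2 * sqrt (b * c)) * sqrt b) * bessel_nn (1 / 2) b c"
    using b by (simp add: distrib_right[symmetric] mult.assoc[symmetric] flip: ennreal_mult ennreal_plus)
  finally have *: "ennreal (exp (2 * sqrt (b * c)) * sqrt b) * bessel_nn (1 / 2) b c = ennreal (sqrt pi)"
    by (simp add: powr_half_sqrt)
  have "sqrt pi / (exp (2 * sqrt (b * c)) * sqrt b) = sqrt (pi / b) * exp (- 2 * sqrt (b * c))"
    by (simp add: real_sqrt_divide exp_minus field_split_simps)
  then show ?thesis
    using ennreal_mult_eq_imp_eq_divide[OF *] b by simp
qed

text \<open>The Gamma integral under the substitution \<open>y = \<tau> * (x\<^sup>2 - 1)\<close>;
  the factor \<open>x\<close> in the integrand is its Jacobian up to a constant.\<close>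

lemma nn_integral_exp_square_powr:
  assumes a: "a > 0" and \<tau>: "\<tau> > 0"
  shows "(\<integral>\<^sup>+x. ennreal (indicator {1<..} x * (x * (x\<^sup>2 - 1) powr (a - 1) * exp (- \<tau> * x\<^sup>2))) \<partial>lborel)
    = ennreal (Gamma a / 2 * \<tau> powr (- a) * exp (- \<tau>))" (is "?J = _")
proof -
  have "ennreal (Gamma a) = (\<integral>\<^sup>+y. ennreal (indicator {0<..} y * (y powr (a - 1) * exp (- 1 * y))) \<partial>lborel)"
    by (subst nn_integral_Gamma_scaled[OF a]) simp_all
  also have "\<dots> = (\<integral>\<^sup>+x. ennreal (indicator {1<..} x * (\<bar>2 * \<tau> * x\<bar> *
      ((\<tau> * (x\<^sup>2 - 1)) powr (a - 1) * exp (- 1 * (\<tau> * (x\<^sup>2 - 1)))))) \<partial>lborel)"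
  proof (rule nn_integral_change_of_variables_real)
    show "(\<lambda>x. \<tau> * (x\<^sup>2 - 1)) ` {1<..} = {0<..}"
    proof safe
      fix x :: real assume "x > 1"
      then have "x\<^sup>2 > 1" by (simp add: one_less_power)
      then show "\<tau> * (x\<^sup>2 - 1) > 0" using \<tau> by simp
    next
      fix y :: real assume "y > 0"
      then show "y \<in> (\<lambda>x. \<tau> * (x\<^sup>2 - 1)) ` {1<..}"
        using \<tau> by (intro image_eqI[of _ _ "sqrt (y / \<tau> + 1)"]) auto
    qed
    show "inj_on (\<lambda>x. \<tau> * (x\<^sup>2 - 1)) {1<..}"
      using \<tau> by (auto intro!: inj_onI simp: power2_eq_iff_nonneg)
  qed (auto intro!: derivative_eq_intros)
  also have "\<dots> = (\<integral>\<^sup>+x. ennreal (2 * \<tau> powr a * exp \<tau>) *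
      ennreal (indicator {1<..} x * (x * (x\<^sup>2 - 1) powr (a - 1) * exp (- \<tau> * x\<^sup>2))) \<partial>lborel)"
  proof (intro nn_integral_cong)
    fix x :: real
    show "ennreal (indicator {1<..} x * (\<bar>2 * \<tau> * x\<bar> *
      ((\<tau> * (x\<^sup>2 - 1)) powr (a - 1) * exp (- 1 * (\<tau> * (x\<^sup>2 - 1)))))) = ennreal (2 * \<tau> powr a * exp \<tau>) *
      ennreal (indicator {1<..} x * (x * (x\<^sup>2 - 1) powr (a - 1) * exp (- \<tau> * x\<^sup>2)))"
    proof (cases "x > 1")
      case True
      then have x2: "x\<^sup>2 > 1" by (simp add: one_less_power)
      have "exp (- 1 * (\<tau> * (x\<^sup>2 - 1))) = exp \<tau> * exp (- \<tau> * x\<^sup>2)"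
        by (simp add: algebra_simps flip: exp_add)
      moreover have "\<tau> * (\<tau> * (x\<^sup>2 - 1)) powr (a - 1) = \<tau> powr a * (x\<^sup>2 - 1) powr (a - 1)"
        using \<tau> x2 by (simp add: powr_mult powr_diff)
      ultimately show ?thesis
        using True \<tau> by (simp add: mult_ac flip: ennreal_mult)
    qed simp
  qed
  also have "\<dots> = ennreal (2 * \<tau> powr a * exp \<tau>) * ?J"
    by (rule nn_integral_cmult) measurable
  finally have *: "ennreal (2 * \<tau> powr a * exp \<tau>) * ?J = ennreal (Gamma a)"
    by (rule sym)
  have "Gamma a / 2 * \<tau> powr (- a) * exp (- \<tau>) = Gamma a / (2 * \<tau> powr a * exp \<tau>)"
    by (simp add: exp_minus powr_minus field_simps)
  moreover have "?J = ennreal (Gamma a / (2 * \<tau> powr a * exp \<tau>))"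
    by (rule ennreal_mult_eq_imp_eq_divide[OF *]) (use a \<tau> in auto)
  ultimately show ?thesis
    by (simp only:)
qed

text \<open>Writing \<open>exp (- r * x)\<close> as a mixture of the Gaussians \<open>exp (- \<tau> * x\<^sup>2)\<close> and integrating over \<open>x\<close>
  first turns the left-hand side into the integral defining the right-hand side.\<close>

lemma nn_integral_exp_quadratic_powr:
  assumes a: "a > 0" and r: "r > 0"
  shows "(\<integral>\<^sup>+x. ennreal (indicator {1<..} x * (exp (- r * x) * (x\<^sup>2 - 1) powr (a - 1))) \<partial>lborel)
    = ennreal (Gamma a / (2 * sqrt pi)) * bessel_nn (1 / 2 - a) 1 (r\<^sup>2 / 4)"
proof -
  \<comment> \<open>By \<open>bessel_nn_half\<close> with \<open>b = x\<^sup>2\<close> and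
    \<open>c = r\<^sup>2 / 4\<close>, integrating \<open>\<tau> powr (1 / 2 - 1) * exp (- \<tau> *
    x\<^sup>2 - r\<^sup>2 / (4 * \<tau>))\<close> over positive \<open>\<tau>\<close> gives
    \<open>sqrt pi / x * exp (- r * x)\<close>. The factor \<open>x / sqrt pi\<close> normalises
    this and at the same time supplies the Jacobian that makes the integral over \<open>x\<close> a
    Gamma integral.\<close>
  let ?k = "\<lambda>x \<tau>. ennreal (indicator {1<..} x * (x * (x\<^sup>2 - 1) powr (a - 1) * exp (- \<tau> * x\<^sup>2)))
      * ennreal (indicator {0<..} \<tau> * (\<tau> powr (1 / 2 - 1) * exp (- (r\<^sup>2 / 4) / \<tau>) / sqrt pi))"
  have "(\<integral>\<^sup>+x. ennreal (indicator {1<..} x * (exp (- r * x) * (x\<^sup>2 - 1) powr (a - 1))) \<partial>lborel)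
    = (\<integral>\<^sup>+x. (\<integral>\<^sup>+\<tau>. ?k x \<tau> \<partial>lborel) \<partial>lborel)"
  proof (rule nn_integral_cong)
    fix x :: real
    show "ennreal (indicator {1<..} x * (exp (- r * x) * (x\<^sup>2 - 1) powr (a - 1))) = (\<integral>\<^sup>+\<tau>. ?k x \<tau> \<partial>lborel)"
    proof (cases "x > 1")
      case True
      have "(\<integral>\<^sup>+\<tau>. ?k x \<tau> \<partial>lborel) = (\<integral>\<^sup>+\<tau>. ennreal (x * (x\<^sup>2 - 1) powr (a - 1) / sqrt pi) *
          ennreal (indicator {0<..} \<tau> * (\<tau> powr (1 / 2 - 1) * exp (- (x\<^sup>2 * \<tau>) - (r\<^sup>2 / 4) / \<tau>))) \<partial>lborel)"
      proof (rule nn_integral_cong)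
        fix \<tau> :: real
        show "?k x \<tau> = ennreal (x * (x\<^sup>2 - 1) powr (a - 1) / sqrt pi) *
          ennreal (indicator {0<..} \<tau> * (\<tau> powr (1 / 2 - 1) * exp (- (x\<^sup>2 * \<tau>) - (r\<^sup>2 / 4) / \<tau>)))"
        proof (cases "\<tau> > 0")
          case True
          have "exp (- (x\<^sup>2 * \<tau>) - (r\<^sup>2 / 4) / \<tau>) = exp (- \<tau> * x\<^sup>2) * exp (- (r\<^sup>2 / 4) / \<tau>)"
            by (simp add: mult.commute flip: exp_add)
          then show ?thesis
            using True \<open>x > 1\<close> by (simp add: ac_simps ennreal_mult[symmetric] del: ennreal_mult')
        qed simp
      qed
      also have "\<dots> = ennreal (x * (x\<^sup>2 - 1) powr (a - 1) / sqrt pi) * bessel_nn (1 / 2) (x\<^sup>2) (r\<^sup>2 / 4)"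
        unfolding bessel_nn_def by (rule nn_integral_cmult) measurable
      also have "\<dots> = ennreal (exp (- r * x) * (x\<^sup>2 - 1) powr (a - 1))"
      proof -
        have "sqrt (pi / x\<^sup>2) * exp (- 2 * sqrt (x\<^sup>2 * (r\<^sup>2 / 4))) = sqrt pi / x * exp (- r * x)"
          using True r by (simp add: real_sqrt_divide real_sqrt_mult mult.commute)
        moreover have "x * (x\<^sup>2 - 1) powr (a - 1) / sqrt pi * (sqrt pi / x * exp (- r * x))
            = exp (- r * x) * (x\<^sup>2 - 1) powr (a - 1)"
          using True by simp
        ultimately show ?thesis
          using True r by (subst bessel_nn_half) (simp_all flip: ennreal_mult)
      qed
      finally show ?thesis
        using True by simp
    qed simp
  qed
  also have "\<dots> = (\<integral>\<^sup>+\<tau>. (\<integral>\<^sup>+x. ?k x \<tau> \<partial>lborel) \<partial>lborel)"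
    by (rule lborel_pair.Fubini') measurable
  also have "\<dots> = (\<integral>\<^sup>+\<tau>. ennreal (Gamma a / (2 * sqrt pi)) *
      ennreal (indicator {0<..} \<tau> * (\<tau> powr (1 / 2 - a - 1) * exp (- (1 * \<tau>) - (r\<^sup>2 / 4) / \<tau>))) \<partial>lborel)"
  proof (rule nn_integral_cong)
    fix \<tau> :: real
    show "(\<integral>\<^sup>+x. ?k x \<tau> \<partial>lborel) = ennreal (Gamma a / (2 * sqrt pi)) *
      ennreal (indicator {0<..} \<tau> * (\<tau> powr (1 / 2 - a - 1) * exp (- (1 * \<tau>) - (r\<^sup>2 / 4) / \<tau>)))"
    proof (cases "\<tau> > 0")
      case True
      have "(\<integral>\<^sup>+x. ?k x \<tau> \<partial>lborel) = ennreal (Gamma a / 2 * \<tau> powr (- a) * exp (- \<tau>))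
          * ennreal (indicator {0<..} \<tau> * (\<tau> powr (1 / 2 - 1) * exp (- (r\<^sup>2 / 4) / \<tau>) / sqrt pi))"
        by (subst nn_integral_exp_square_powr[OF a True, symmetric]) (rule nn_integral_multc, measurable)
      moreover have "\<tau> powr (1 / 2 - a - 1) = \<tau> powr (- a) * \<tau> powr (1 / 2 - 1)"
        unfolding powr_add[symmetric] by (rule arg_cong2[where f="(powr)"]) simp_all
      moreover have "exp (- (1 * \<tau>) - (r\<^sup>2 / 4) / \<tau>) = exp (- \<tau>) * exp (- (r\<^sup>2 / 4) / \<tau>)"
        by (simp flip: exp_add)
      ultimately show ?thesis
        using True a by (simp add: mult_ac flip: ennreal_mult)
    qed simp
  qed
  also have "\<dots> = ennreal (Gamma a / (2 * sqrt pi)) * bessel_nn (1 / 2 - a) 1 (r\<^sup>2 / 4)"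
    unfolding bessel_nn_def by (rule nn_integral_cmult) measurable
  finally show ?thesis .
qed

subsection \<open>Asymptotic expansion\<close>

text \<open>Taylor's formula with Lagrange remainder at an intermediate \<open>t\<close>: as
  \<open>1 \<le> 1 + t \<le> 1 + w\<close> and \<open>b - N \<le> K\<close>, the factor
  \<open>(1 + t) powr (b - N)\<close> is at most \<open>(1 + w) ^ K\<close>. The bound holds beyond
  the radius of convergence and grows only polynomially, so it can be integrated against an
  exponential over the whole half-line.\<close>

lemma powr_binomial_remainder:
  fixes b w :: real
  assumes w: "w > 0" and K: "\<bar>b\<bar> \<le> real K"
  shows "\<bar>(1 + w) powr b - (\<Sum>j<N. (b gchoose j) * w ^ j)\<bar> \<le> \<bar>b gchoose N\<bar> * w ^ N * (1 + w) ^ K"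
proof -
  define diff where "diff = (\<lambda>m t. fact m * (b gchoose m) * (1 + t) powr (b - real m))"
  have "DERIV (diff m) t :> diff (Suc m) t" if "0 \<le> t" for m t
  proof -
    have Suc: "fact (Suc m) * (b gchoose Suc m) = fact m * (b gchoose m) * (b - real m)"
      using gbinomial_mult_1[of b m] by (simp add: algebra_simps)
    have "DERIV (\<lambda>t. (1 + t) powr (b - real m)) t :> (b - real m) * (1 + t) powr (b - real m - 1)"
      using that by (intro DERIV_chain2[OF has_real_derivative_powr, THEN DERIV_cong]) (auto intro!: derivative_eq_intros)
    from DERIV_cmult[OF this, of "fact m * (b gchoose m)"] show ?thesis
      unfolding diff_def Suc by (simp add: algebra_simps)
  qed
  then obtain t where t: "0 < t" "t \<le> w"
    and eq: "(1 + w) powr b = (\<Sum>m<N. diff m 0 / fact m * w ^ m) + diff N t / fact N * w ^ N"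
    using Maclaurin2[of w diff "\<lambda>t. (1 + t) powr b" N] w by (auto simp: diff_def)
  have "(\<Sum>m<N. diff m 0 / fact m * w ^ m) = (\<Sum>j<N. (b gchoose j) * w ^ j)"
    by (simp add: diff_def)
  with eq have "(1 + w) powr b - (\<Sum>j<N. (b gchoose j) * w ^ j) = (b gchoose N) * w ^ N * (1 + t) powr (b - real N)"
    by (simp add: diff_def)
  moreover have "(1 + t) powr (b - real N) \<le> (1 + w) ^ K"
  proof -
    have "(1 + t) powr (b - real N) \<le> (1 + t) powr real K"
      using t K by (intro powr_mono) auto
    also have "\<dots> \<le> (1 + w) powr real K"
      using t by (intro powr_mono2) auto
    finally show ?thesis
      using w by (simp add: powr_realpow)
  qed
  ultimately show ?thesis
    using w by (simp add: abs_mult mult_left_mono)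
qed

lemma has_bochner_integral_Gamma_scaled:
  assumes "a > 0" "c > (0::real)"
  shows "has_bochner_integral lborel (\<lambda>v. indicator {0<..} v * (v powr (a - 1) * exp (- c * v))) (Gamma a * c powr (- a))"
proof (rule has_bochner_integral_nn_integral)
  show "(\<integral>\<^sup>+v. ennreal (indicator {0<..} v * (v powr (a - 1) * exp (- c * v))) \<partial>lborel) = ennreal (Gamma a * c powr (- a))"
    using nn_integral_Gamma_scaled[OF assms] .
qed (use assms in auto)

text \<open>Watson's lemma for a binomial factor: each power of \<open>v\<close> integrates to a
  Gamma value times a power of \<open>r\<close>, and the remainder bound is again made of such
  powers. The constant is fixed before \<open>r\<close>; the equation with \<open>ennreal J\<close>
  includes convergence.\<close>

lemma watson_binomial:
  fixes a b :: real
  assumes a: "a > 0"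
  obtains C where "\<And>r. r \<ge> 1 \<Longrightarrow> \<exists>J\<ge>0.
      (\<integral>\<^sup>+v. ennreal (indicator {0<..} v * (v powr (a - 1) * exp (- r * v) * (1 + v / 2) powr b)) \<partial>lborel) = ennreal J
    \<and> \<bar>J - (\<Sum>j<N. (b gchoose j) / 2 ^ j * Gamma (a + real j) * r powr (- a - real j))\<bar> \<le> C * r powr (- a - real N)"
proof -
  define K where "K = nat \<lceil>\<bar>b\<bar>\<rceil>"
  have K: "\<bar>b\<bar> \<le> real K" by (simp add: K_def)
  define D where "D = \<bar>b gchoose N\<bar> * 2 ^ K"
  define C where "C = D * (Gamma (a + real N) + Gamma (a + real (N + K)))"
  have "\<exists>J\<ge>0.
      (\<integral>\<^sup>+v. ennreal (indicator {0<..} v * (v powr (a - 1) * exp (- r * v) * (1 + v / 2) powr b)) \<partial>lborel) = ennreal J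
    \<and> \<bar>J - (\<Sum>j<N. (b gchoose j) / 2 ^ j * Gamma (a + real j) * r powr (- a - real j))\<bar> \<le> C * r powr (- a - real N)"
    if r: "r \<ge> 1" for r
  proof -
    define f where "f = (\<lambda>v. indicator {0<..} v * (v powr (a - 1) * exp (- r * v) * (1 + v / 2) powr b) :: real)"
    define h where "h = (\<lambda>j v. indicator {0<..} v * (v powr (a + real j - 1) * exp (- r * v)) :: real)"
    define S where "S = (\<lambda>v. \<Sum>j<N. (b gchoose j) / 2 ^ j * h j v)"
    have h: "has_bochner_integral lborel (h j) (Gamma (a + real j) * r powr (- a - real j))" for j
      using has_bochner_integral_Gamma_scaled[of "a + real j" r] a r
      unfolding h_def by simp
    have [measurable]: "f \<in> borel_measurable lborel" "h j \<in> borel_measurable lborel" for j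
      unfolding f_def h_def by measurable
    have S: "has_bochner_integral lborel S (\<Sum>j<N. (b gchoose j) / 2 ^ j * (Gamma (a + real j) * r powr (- a - real j)))"
      unfolding S_def by (intro has_bochner_integral_sum has_bochner_integral_mult_right h)
    have B: "has_bochner_integral lborel (\<lambda>v. D * (h N v + h (N + K) v))
        (D * (Gamma (a + real N) * r powr (- a - real N) + Gamma (a + real (N + K)) * r powr (- a - real (N + K))))"
      by (intro has_bochner_integral_mult_right has_bochner_integral_add h)
    have bound: "\<bar>f v - S v\<bar> \<le> D * (h N v + h (N + K) v)" for v
    proof (cases "v > 0")
      case True
      have hj: "h j v = v powr (a - 1) * exp (- r * v) * v ^ j" for j
      proof -
        have "v powr (a + real j - 1) = v powr ((a - 1) + real j)"
          by (simp add: algebra_simps)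
        also have "\<dots> = v powr (a - 1) * v ^ j"
          using True by (simp only: powr_add powr_realpow)
        finally show ?thesis
          using True by (simp add: h_def)
      qed
      have "f v - S v = v powr (a - 1) * exp (- r * v) * ((1 + v / 2) powr b - (\<Sum>j<N. (b gchoose j) * (v / 2) ^ j))"
        using True by (simp add: f_def S_def hj sum_distrib_left right_diff_distrib power_divide mult_ac)
      then have "\<bar>f v - S v\<bar> = v powr (a - 1) * exp (- r * v) * \<bar>(1 + v / 2) powr b - (\<Sum>j<N. (b gchoose j) * (v / 2) ^ j)\<bar>"
        by (simp add: abs_mult)
      also have "\<dots> \<le> v powr (a - 1) * exp (- r * v) * (\<bar>b gchoose N\<bar> * (v / 2) ^ N * (1 + v / 2) ^ K)"
        using True by (intro mult_left_mono powr_binomial_remainder K) auto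
      \<comment> \<open>Bounding \<open>(1 + v / 2) ^ K\<close> by the pure powers 1 and
        \<open>v ^ K\<close> turns the estimate into the two Gamma integrands \<open>h N\<close> and
        \<open>h (N + K)\<close>.\<close>
      also have "\<dots> \<le> v powr (a - 1) * exp (- r * v) * (\<bar>b gchoose N\<bar> * v ^ N * (2 ^ K * (1 + v ^ K)))"
      proof (intro mult_left_mono mult_mono)
        show "(v / 2) ^ N \<le> v ^ N"
          using True by (intro power_mono) auto
        show "(1 + v / 2) ^ K \<le> 2 ^ K * (1 + v ^ K)"
        proof (cases "v \<le> 1")
          case vle: True
          have "(1 + v / 2) ^ K \<le> 2 ^ K"
            using True vle by (intro power_mono) auto
          also have "\<dots> \<le> 2 ^ K * (1 + v ^ K)"
            using True by simp
          finally show ?thesis .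
        next
          case False
          have "(1 + v / 2) ^ K \<le> (2 * v) ^ K"
            using False by (intro power_mono) auto
          also have "\<dots> \<le> 2 ^ K * (1 + v ^ K)"
            by (simp add: power_mult_distrib)
          finally show ?thesis .
        qed
      qed (use True in auto)
      also have "\<dots> = D * (h N v + h (N + K) v)"
        by (simp add: hj D_def power_add algebra_simps)
      finally show ?thesis .
    qed (simp add: f_def S_def h_def)
    have intR: "integrable lborel (\<lambda>v. f v - S v)"
    proof (rule Bochner_Integration.integrable_bound[OF integrable.intros[OF B]])
      show "(\<lambda>v. f v - S v) \<in> borel_measurable lborel"
        unfolding S_def by measurable
      show "AE v in lborel. norm (f v - S v) \<le> norm (D * (h N v + h (N + K) v))"
        using order_trans[OF bound abs_ge_self] by (intro AE_I2) simp
    qed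
    have intS: "integrable lborel S"
      using S by (rule integrable.intros)
    have intf: "integrable lborel f"
      using Bochner_Integration.integrable_add[OF intR intS] by simp
    define J where "J = (\<integral>v. f v \<partial>lborel)"
    have f_nonneg: "0 \<le> f v" for v by (simp add: f_def)
    have "J - (\<Sum>j<N. (b gchoose j) / 2 ^ j * Gamma (a + real j) * r powr (- a - real j)) = (\<integral>v. f v - S v \<partial>lborel)"
      using Bochner_Integration.integral_diff[OF intf intS] has_bochner_integral_integral_eq[OF S]
      by (simp add: J_def mult.assoc)
    also have "\<bar>\<dots>\<bar> \<le> (\<integral>v. D * (h N v + h (N + K) v) \<partial>lborel)"
      using Bochner_Integration.integral_norm_bound_integral[OF intR integrable.intros[OF B]] bound by simp
    also have "\<dots> = D * (Gamma (a + real N) * r powr (- a - real N) + Gamma (a + real (N + K)) * r powr (- a - real (N + K)))"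
      using B by (rule has_bochner_integral_integral_eq)
    \<comment> \<open>Here \<open>r \<ge> 1\<close> absorbs the power with \<open>N + K\<close> into
      the one with \<open>N\<close>.\<close>
    also have "\<dots> \<le> D * (Gamma (a + real N) * r powr (- a - real N) + Gamma (a + real (N + K)) * r powr (- a - real N))"
      using a r by (intro mult_left_mono add_left_mono powr_mono) (auto simp: D_def intro!: Gamma_real_nonneg)
    also have "\<dots> = C * r powr (- a - real N)"
      by (simp add: C_def algebra_simps)
    finally have "\<bar>J - (\<Sum>j<N. (b gchoose j) / 2 ^ j * Gamma (a + real j) * r powr (- a - real j))\<bar> \<le> C * r powr (- a - real N)" .
    moreover have "(\<integral>\<^sup>+v. ennreal (f v) \<partial>lborel) = ennreal J" "J \<ge> 0"
      using nn_integral_eq_integral[OF intf] f_nonneg by (auto simp: J_def)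
    ultimately show ?thesis
      unfolding f_def by blast
  qed
  then show ?thesis
    using that by blast
qed

section \<open>Algebra of the expansion coefficients\<close>

lemma Gamma_quotient_0 [simp]: "Gamma_quotient a 0 = 1"
  by (simp add: Gamma_quotient_def)

lemma Gamma_quotient_Suc: "Gamma_quotient a (Suc j) = (a - real (Suc j)) * (a + real j) * Gamma_quotient a j"
proof -
  have "{- int (Suc j)..int (Suc j) - 1} = insert (- int (Suc j)) (insert (int j) {- int j..int j - 1})"
    by auto
  then show ?thesis
    by (simp add: Gamma_quotient_def)
qed

text \<open>The two factors gained from \<open>j\<close> to \<open>Suc j\<close>,
  \<open>a - real (Suc j)\<close> and \<open>a + real j\<close>, are swapped up to sign by
  \<open>a \<mapsto> 1 - a\<close>, so their product is invariant.\<close>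

lemma Gamma_quotient_reflect: "Gamma_quotient (1 - a) j = Gamma_quotient a j"
proof (induction j)
  case (Suc j)
  have "(1 - a - real (Suc j)) * (1 - a + real j) = (a - real (Suc j)) * (a + real j)"
    by (simp add: algebra_simps)
  with Suc show ?case by (simp add: Gamma_quotient_Suc)
qed simp

text \<open>The binomial coefficient supplies the factors \<open>a - 1\<close> down to
  \<open>a - j\<close>, the Gamma value those from \<open>a\<close> up to \<open>a + j - 1\<close>;
  together they are the product in \<open>Gamma_quotient\<close>. No division by
  \<open>Gamma (a - j)\<close> occurs, so its poles at integer \<open>a\<close> do no harm.\<close>

lemma gbinomial_Gamma_eq_Gamma_quotient:
  assumes "a > 0"
  shows "(a - 1 gchoose j) * Gamma (a + real j) = Gamma a * Gamma_quotient a j / fact j"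
proof -
  have "fact j * (a - 1 gchoose j) * Gamma (a + real j) = Gamma a * Gamma_quotient a j"
  proof (induction j)
    case (Suc j)
    have "fact (Suc j) * (a - 1 gchoose Suc j) = fact j * (a - 1 gchoose j) * (a - real (Suc j))"
      using gbinomial_mult_1[of "a - 1" j] by (simp add: algebra_simps)
    moreover have "Gamma (a + real (Suc j)) = (a + real j) * Gamma (a + real j)"
    proof -
      have "a + real j \<notin> \<int>\<^sub>\<le>\<^sub>0"
        using assms by (auto dest: nonpos_Ints_nonpos)
      then show ?thesis
        using Gamma_plus1[of "a + real j"] by (simp add: add_ac)
    qed
    ultimately have "fact (Suc j) * (a - 1 gchoose Suc j) * Gamma (a + real (Suc j))
        = (a - real (Suc j)) * (a + real j) * (fact j * (a - 1 gchoose j) * Gamma (a + real j))"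
      by (simp only: mult_ac)
    then show ?case
      unfolding Suc.IH by (simp add: Gamma_quotient_Suc)
  qed simp
  then show ?thesis
    by (simp add: field_simps)
qed

text \<open>For \<open>x = 1 + v\<close> one has
  \<open>x\<^sup>2 - 1 = 2 * (v * (1 + v / 2))\<close>, which is where \<open>2 powr b\<close> comes
  from; the exponential decay \<open>exp (- r)\<close> is the value at the endpoint
  \<open>x = 1\<close>.\<close>

lemma nn_integral_exp_quadratic_powr_shift:
  assumes r: "r > 0"
  shows "(\<integral>\<^sup>+x. ennreal (indicator {1<..} x * (exp (- r * x) * (x\<^sup>2 - 1) powr b)) \<partial>lborel)
    = ennreal (exp (- r) * 2 powr b) *
      (\<integral>\<^sup>+v. ennreal (indicator {0<..} v * (v powr b * exp (- r * v) * (1 + v / 2) powr b)) \<partial>lborel)"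
proof -
  have "(\<integral>\<^sup>+x. ennreal (indicator {1<..} x * (exp (- r * x) * (x\<^sup>2 - 1) powr b)) \<partial>lborel)
      = (\<integral>\<^sup>+v. ennreal (indicator {1<..} (1 + 1 * v) * (exp (- r * (1 + 1 * v)) * ((1 + 1 * v)\<^sup>2 - 1) powr b)) \<partial>lborel)"
    by (subst nn_integral_real_affine[where c=1 and t=1]) simp_all
  also have "\<dots> = (\<integral>\<^sup>+v. ennreal (exp (- r) * 2 powr b) *
      ennreal (indicator {0<..} v * (v powr b * exp (- r * v) * (1 + v / 2) powr b)) \<partial>lborel)"
  proof (rule nn_integral_cong)
    fix v :: real
    show "ennreal (indicator {1<..} (1 + 1 * v) * (exp (- r * (1 + 1 * v)) * ((1 + 1 * v)\<^sup>2 - 1) powr b))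
        = ennreal (exp (- r) * 2 powr b) *
      ennreal (indicator {0<..} v * (v powr b * exp (- r * v) * (1 + v / 2) powr b))"
    proof (cases "v > 0")
      case True
      have "(1 + 1 * v)\<^sup>2 - 1 = 2 * (v * (1 + v / 2))"
        by (simp add: power2_eq_square algebra_simps)
      then have "((1 + 1 * v)\<^sup>2 - 1) powr b = 2 powr b * (v powr b * (1 + v / 2) powr b)"
        using True by (simp only: powr_mult)
      moreover have "exp (- r * (1 + 1 * v)) = exp (- r) * exp (- r * v)"
        by (simp add: algebra_simps flip: exp_add)
      ultimately have "exp (- r * (1 + 1 * v)) * ((1 + 1 * v)\<^sup>2 - 1) powr b
          = exp (- r) * 2 powr b * (v powr b * exp (- r * v) * (1 + v / 2) powr b)"
        by (simp only: mult_ac)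
      then show ?thesis
        using True by (simp flip: ennreal_mult)
    qed simp
  qed
  also have "\<dots> = ennreal (exp (- r) * 2 powr b) *
      (\<integral>\<^sup>+v. ennreal (indicator {0<..} v * (v powr b * exp (- r * v) * (1 + v / 2) powr b)) \<partial>lborel)"
    by (rule nn_integral_cmult) measurable
  finally show ?thesis .
qed

lemma bessel_nn_expansion_pos:
  assumes a: "a > 0"
  obtains C where "\<And>r. r \<ge> 1 \<Longrightarrow>
    \<bar>enn2real (bessel_nn (1 / 2 - a) 1 (r\<^sup>2 / 4)) - sqrt pi * 2 powr a * exp (- r) *
      (\<Sum>j<N. 1 / (2 ^ j * fact j) * Gamma_quotient a j * r powr (- a - real j))\<bar>
    \<le> C * (r powr (- a - real N) * exp (- r))"
proof -
  obtain C where C: "\<And>r. r \<ge> 1 \<Longrightarrow> \<exists>J\<ge>0.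
      (\<integral>\<^sup>+v. ennreal (indicator {0<..} v * (v powr (a - 1) * exp (- r * v) * (1 + v / 2) powr (a - 1))) \<partial>lborel) = ennreal J
    \<and> \<bar>J - (\<Sum>j<N. (a - 1 gchoose j) / 2 ^ j * Gamma (a + real j) * r powr (- a - real j))\<bar> \<le> C * r powr (- a - real N)"
    using watson_binomial[OF a] by blast
  \<comment> \<open>This is \<open>2 powr (a - 1)\<close>, left over from the shift to
    \<open>v\<close>, divided by the factor \<open>Gamma a / (2 * sqrt pi)\<close> in front of the
    Bessel integral.\<close>
  define c where "c = sqrt pi * 2 powr a / Gamma a"
  have Gam: "Gamma a > 0" using a by (rule Gamma_real_pos)
  then have c: "c > 0" by (simp add: c_def)
  have "\<bar>enn2real (bessel_nn (1 / 2 - a) 1 (r\<^sup>2 / 4)) - sqrt pi * 2 powr a * exp (- r) *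
      (\<Sum>j<N. 1 / (2 ^ j * fact j) * Gamma_quotient a j * r powr (- a - real j))\<bar>
    \<le> c * C * (r powr (- a - real N) * exp (- r))" if r: "r \<ge> 1" for r
  proof -
    obtain J where J: "J \<ge> 0"
      "(\<integral>\<^sup>+v. ennreal (indicator {0<..} v * (v powr (a - 1) * exp (- r * v) * (1 + v / 2) powr (a - 1))) \<partial>lborel) = ennreal J"
      "\<bar>J - (\<Sum>j<N. (a - 1 gchoose j) / 2 ^ j * Gamma (a + real j) * r powr (- a - real j))\<bar> \<le> C * r powr (- a - real N)"
      using C[OF r] by blast
    have r0: "r > 0" using r by simp
    have "ennreal (Gamma a / (2 * sqrt pi)) * bessel_nn (1 / 2 - a) 1 (r\<^sup>2 / 4)
        = ennreal (exp (- r) * 2 powr (a - 1)) * ennreal J"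
      using nn_integral_exp_quadratic_powr[OF a r0] nn_integral_exp_quadratic_powr_shift[OF r0, of "a - 1"]
      unfolding J(2) by (simp only:)
    then have "ennreal (Gamma a / (2 * sqrt pi)) * bessel_nn (1 / 2 - a) 1 (r\<^sup>2 / 4)
        = ennreal (exp (- r) * 2 powr (a - 1) * J)"
      using J(1) by (simp add: ennreal_mult)
    then have "bessel_nn (1 / 2 - a) 1 (r\<^sup>2 / 4) = ennreal (exp (- r) * 2 powr (a - 1) * J / (Gamma a / (2 * sqrt pi)))"
      using Gam J(1) by (intro ennreal_mult_eq_imp_eq_divide) auto
    moreover have "exp (- r) * 2 powr (a - 1) * J / (Gamma a / (2 * sqrt pi)) = c * exp (- r) * J"
      by (simp add: c_def powr_diff)
    ultimately have B: "enn2real (bessel_nn (1 / 2 - a) 1 (r\<^sup>2 / 4)) = c * exp (- r) * J"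
      using c J(1) by simp
    have coeff: "c * ((a - 1 gchoose j) / 2 ^ j * Gamma (a + real j) * x)
        = sqrt pi * 2 powr a * (1 / (2 ^ j * fact j) * Gamma_quotient a j * x)" for j x
    proof -
      have "c * ((a - 1 gchoose j) / 2 ^ j * Gamma (a + real j) * x)
          = c / 2 ^ j * ((a - 1 gchoose j) * Gamma (a + real j)) * x"
        by simp
      also have "\<dots> = sqrt pi * 2 powr a * (1 / (2 ^ j * fact j) * Gamma_quotient a j * x)"
        unfolding gbinomial_Gamma_eq_Gamma_quotient[OF a] c_def using Gam by simp
      finally show ?thesis .
    qed
    have "sqrt pi * 2 powr a * exp (- r) * (\<Sum>j<N. 1 / (2 ^ j * fact j) * Gamma_quotient a j * r powr (- a - real j))
        = exp (- r) * (\<Sum>j<N. sqrt pi * 2 powr a * (1 / (2 ^ j * fact j) * Gamma_quotient a j * r powr (- a - real j)))"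
      by (simp only: sum_distrib_left mult_ac)
    also have "\<dots> = exp (- r) * (c * (\<Sum>j<N. (a - 1 gchoose j) / 2 ^ j * Gamma (a + real j) * r powr (- a - real j)))"
      unfolding sum_distrib_left[of c] coeff ..
    finally have "enn2real (bessel_nn (1 / 2 - a) 1 (r\<^sup>2 / 4)) - sqrt pi * 2 powr a * exp (- r) *
      (\<Sum>j<N. 1 / (2 ^ j * fact j) * Gamma_quotient a j * r powr (- a - real j))
      = c * exp (- r) * (J - (\<Sum>j<N. (a - 1 gchoose j) / 2 ^ j * Gamma (a + real j) * r powr (- a - real j)))"
      unfolding B by (simp only: right_diff_distrib mult_ac)
    then have "\<bar>enn2real (bessel_nn (1 / 2 - a) 1 (r\<^sup>2 / 4)) - sqrt pi * 2 powr a * exp (- r) *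
      (\<Sum>j<N. 1 / (2 ^ j * fact j) * Gamma_quotient a j * r powr (- a - real j))\<bar>
      = c * exp (- r) * \<bar>J - (\<Sum>j<N. (a - 1 gchoose j) / 2 ^ j * Gamma (a + real j) * r powr (- a - real j))\<bar>"
      using c by (simp only: abs_mult abs_of_pos abs_exp_cancel)
    also have "\<dots> \<le> c * exp (- r) * (C * r powr (- a - real N))"
      using c J(3) by (intro mult_left_mono) auto
    finally show ?thesis
      by (simp only: mult_ac)
  qed
  then show ?thesis
    using that by blast
qed

lemma bessel_nn_expansion:
  fixes a :: real
  obtains C where "\<And>r. r \<ge> 1 \<Longrightarrow>
    \<bar>enn2real (bessel_nn (1 / 2 - a) 1 (r\<^sup>2 / 4)) - sqrt pi * 2 powr a * exp (- r) *
      (\<Sum>j<N. 1 / (2 ^ j * fact j) * Gamma_quotient a j * r powr (- a - real j))\<bar>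
    \<le> C * (r powr (- a - real N) * exp (- r))"
proof (cases "a > 0")
  case True
  then show ?thesis
    using bessel_nn_expansion_pos that by blast
next
  case False
  then have a': "1 - a > 0" by simp
  obtain C where C: "\<And>r. r \<ge> 1 \<Longrightarrow>
    \<bar>enn2real (bessel_nn (1 / 2 - (1 - a)) 1 (r\<^sup>2 / 4)) - sqrt pi * 2 powr (1 - a) * exp (- r) *
      (\<Sum>j<N. 1 / (2 ^ j * fact j) * Gamma_quotient (1 - a) j * r powr (- (1 - a) - real j))\<bar>
    \<le> C * (r powr (- (1 - a) - real N) * exp (- r))"
    using bessel_nn_expansion_pos[OF a'] by blast
  have "\<bar>enn2real (bessel_nn (1 / 2 - a) 1 (r\<^sup>2 / 4)) - sqrt pi * 2 powr a * exp (- r) *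
      (\<Sum>j<N. 1 / (2 ^ j * fact j) * Gamma_quotient a j * r powr (- a - real j))\<bar>
    \<le> 2 powr (2 * a - 1) * C * (r powr (- a - real N) * exp (- r))" if r: "r \<ge> 1" for r
  proof -
    \<comment> \<open>The reflection factor at \<open>b = 1\<close>,
      \<open>c = r\<^sup>2 / 4\<close>, \<open>p = 1 / 2 - a\<close>. It equals
      \<open>(r / 2) powr (1 - 2 * a)\<close>: its power of \<open>r\<close> moves every exponent,
      that of the error included, from \<open>- (1 - a) - x\<close> to \<open>- a - x\<close>, and
      its power of 2 turns \<open>2 powr (1 - a)\<close> into \<open>2 powr a\<close>.\<close>
    define u where "u = (r\<^sup>2 / 4 / 1) powr (1 / 2 - a)"
    have u: "u = 2 powr (2 * a - 1) * r powr (1 - 2 * a)"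
    proof -
      have "u = ((r / 2) powr 2) powr (1 / 2 - a)"
        using r by (simp add: u_def power_divide)
      also have "\<dots> = (r / 2) powr (1 - 2 * a)"
        by (simp add: powr_powr right_diff_distrib)
      also have "\<dots> = 2 powr (2 * a - 1) * r powr (1 - 2 * a)"
        using r powr_minus_divide[of 2 "1 - 2 * a"] by (simp add: powr_divide)
      finally show ?thesis .
    qed
    have up: "u * r powr (- (1 - a) - x) = 2 powr (2 * a - 1) * r powr (- a - x)" for x
    proof -
      have "r powr (1 - 2 * a) * r powr (- (1 - a) - x) = r powr (- a - x)"
        unfolding powr_add[symmetric] by (rule arg_cong2[where f="(powr)"]) simp_all
      then show ?thesis
        by (simp only: u mult.assoc)
    qed
    have two: "2 powr (1 - a) * 2 powr (2 * a - 1) = 2 powr a"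
      unfolding powr_add[symmetric] by (rule arg_cong2[where f="(powr)"]) simp_all
    have u0: "u \<ge> 0" by (simp add: u_def)
    have "enn2real (bessel_nn (1 / 2 - a) 1 (r\<^sup>2 / 4)) = u * enn2real (bessel_nn (1 / 2 - (1 - a)) 1 (r\<^sup>2 / 4))"
      using bessel_nn_reflect[of 1 "r\<^sup>2 / 4" "1 / 2 - a"] r by (simp add: u_def enn2real_mult)
    moreover have "sqrt pi * 2 powr a * exp (- r) *
        (\<Sum>j<N. 1 / (2 ^ j * fact j) * Gamma_quotient a j * r powr (- a - real j))
      = u * (sqrt pi * 2 powr (1 - a) * exp (- r) *
        (\<Sum>j<N. 1 / (2 ^ j * fact j) * Gamma_quotient (1 - a) j * r powr (- (1 - a) - real j)))"
    proof -
      have "u * (\<Sum>j<N. 1 / (2 ^ j * fact j) * Gamma_quotient (1 - a) j * r powr (- (1 - a) - real j))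
          = (\<Sum>j<N. 1 / (2 ^ j * fact j) * Gamma_quotient a j * (u * r powr (- (1 - a) - real j)))"
        by (simp only: sum_distrib_left Gamma_quotient_reflect mult_ac)
      also have "\<dots> = 2 powr (2 * a - 1) * (\<Sum>j<N. 1 / (2 ^ j * fact j) * Gamma_quotient a j * r powr (- a - real j))"
        unfolding up by (simp only: sum_distrib_left mult_ac)
      finally have *: "u * (\<Sum>j<N. 1 / (2 ^ j * fact j) * Gamma_quotient (1 - a) j * r powr (- (1 - a) - real j))
          = 2 powr (2 * a - 1) * (\<Sum>j<N. 1 / (2 ^ j * fact j) * Gamma_quotient a j * r powr (- a - real j))" .
      show ?thesis
        unfolding two[symmetric] using * by (simp only: mult_ac) (metis (no_types, lifting) mult.left_commute)
    qed
    ultimately have "\<bar>enn2real (bessel_nn (1 / 2 - a) 1 (r\<^sup>2 / 4)) - sqrt pi * 2 powr a * exp (- r) *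
      (\<Sum>j<N. 1 / (2 ^ j * fact j) * Gamma_quotient a j * r powr (- a - real j))\<bar>
      = u * \<bar>enn2real (bessel_nn (1 / 2 - (1 - a)) 1 (r\<^sup>2 / 4)) - sqrt pi * 2 powr (1 - a) * exp (- r) *
      (\<Sum>j<N. 1 / (2 ^ j * fact j) * Gamma_quotient (1 - a) j * r powr (- (1 - a) - real j))\<bar>"
      using u0 by (simp only: right_diff_distrib[symmetric] abs_mult abs_of_nonneg)
    also have "\<dots> \<le> u * (C * (r powr (- (1 - a) - real N) * exp (- r)))"
      using C[OF r] u0 by (rule mult_left_mono)
    also have "\<dots> = C * exp (- r) * (u * r powr (- (1 - a) - real N))"
      by (simp only: mult_ac)
    also have "\<dots> = 2 powr (2 * a - 1) * C * (r powr (- a - real N) * exp (- r))"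
      unfolding up by (simp only: mult_ac)
    finally show ?thesis .
  qed
  then show ?thesis
    using that by blast
qed

subsection \<open>The density for exponent 2\<close>

definition bessel_integrand :: "real \<Rightarrow> real \<Rightarrow> real \<Rightarrow> real" where
  "bessel_integrand p c s = indicator {0<..} s * (s powr (p - 1) * exp (- s - c / s))"

lemma borel_measurable_bessel_integrand [measurable]: "bessel_integrand p c \<in> borel_measurable borel"
  unfolding bessel_integrand_def by measurable

lemma bessel_integrand_nonneg [simp]: "0 \<le> bessel_integrand p c s"
  by (simp add: bessel_integrand_def)

text \<open>Valid also where the integral diverges: \<open>enn2real\<close> maps infinity to 0, and
  the Bochner integral of a function that is not integrable is 0. This covers \<open>c = 0\<close>,
  which corresponds to the origin.\<close>

lemma enn2real_bessel_nn: "enn2real (bessel_nn p 1 c) = (\<integral>s. bessel_integrand p c s \<partial>lborel)"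
  by (subst integral_eq_nn_integral) (auto simp: bessel_nn_def bessel_integrand_def)

text \<open>Near 0 the factor \<open>exp (- c / s)\<close> beats every power of \<open>s\<close>: it
  is at most \<open>(m / c) ^ m * s ^ m\<close>. This leaves a Gamma integrand with exponent
  parameter \<open>p + m\<close>, and \<open>m\<close> is taken large enough to make that
  positive.\<close>

lemma integrable_bessel_integrand:
  assumes c: "c > 0"
  shows "integrable lborel (bessel_integrand p c)"
proof -
  define m where "m = nat \<lceil>\<bar>p\<bar>\<rceil> + 1"
  have m: "m > 0" "p + real m > 0"
    unfolding m_def by linarith+
  have "integrable lborel (\<lambda>s. (real m / c) ^ m * (indicator {0<..} s * (s powr (p + real m - 1) * exp (- 1 * s))))"
  proof (intro integrable_mult_right integrableI_nn_integral_finite)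
    show "(\<integral>\<^sup>+s. ennreal (indicator {0<..} s * (s powr (p + real m - 1) * exp (- 1 * s))) \<partial>lborel)
        = ennreal (Gamma (p + real m) * 1 powr - (p + real m))"
      using nn_integral_Gamma_scaled[OF m(2), of 1] by simp
  qed auto
  then show ?thesis
  proof (rule Bochner_Integration.integrable_bound)
    show "AE s in lborel. norm (bessel_integrand p c s)
        \<le> norm ((real m / c) ^ m * (indicator {0<..} s * (s powr (p + real m - 1) * exp (- 1 * s))))"
    proof (rule AE_I2)
      fix s :: real
      show "norm (bessel_integrand p c s)
        \<le> norm ((real m / c) ^ m * (indicator {0<..} s * (s powr (p + real m - 1) * exp (- 1 * s))))"
      proof (cases "s > 0")
        case True
        have "(c / s / real m) ^ m \<le> (1 + c / s / real m) ^ m"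
          using True c by (intro power_mono) auto
        also have "\<dots> \<le> exp (c / s)"
          using True c m(1) by (intro exp_ge_one_plus_x_over_n_power_n) (auto intro: order_trans[of _ 0])
        finally have "exp (- (c / s)) \<le> 1 / (c / s / real m) ^ m"
          using True c m(1) by (simp add: exp_minus inverse_eq_divide frac_le)
        also have "\<dots> = (real m / c) ^ m * s ^ m"
          using True c by (simp add: power_divide power_mult_distrib field_simps)
        finally have "s powr (p - 1) * exp (- s) * exp (- (c / s))
            \<le> s powr (p - 1) * exp (- s) * ((real m / c) ^ m * s ^ m)"
          by (rule mult_left_mono) simp
        moreover have "s powr (p + real m - 1) = s powr (p - 1) * s ^ m"
        proof -
          have "s powr (p + real m - 1) = s powr ((p - 1) + real m)"
            by (simp add: algebra_simps)
          then show ?thesis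
            using True by (simp only: powr_add powr_realpow)
        qed
        moreover have "exp (- s - c / s) = exp (- s) * exp (- (c / s))"
          by (simp flip: exp_add)
        ultimately show ?thesis
          using True c by (simp add: bessel_integrand_def mult_ac)
      qed (simp add: bessel_integrand_def)
    qed
  qed measurable
qed

lemma continuous_on_bessel: "continuous_on {0<..} (\<lambda>c. enn2real (bessel_nn p 1 c))"
proof -
  have "isCont (\<lambda>c. enn2real (bessel_nn p 1 c)) c" if c: "c > 0" for c
  proof -
    \<comment> \<open>The integrand decreases in its second parameter, so the one at
      \<open>c / 2\<close> dominates on a whole neighbourhood of \<open>c\<close>. No single
      dominating function of this kind would serve all positive parameters.\<close>
    have "continuous_on {c / 2..} (\<lambda>c. enn2real (bessel_nn p 1 c))"
      unfolding continuous_on_sequentially o_def enn2real_bessel_nn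
    proof (intro allI ballI impI, elim conjE)
      fix x l assume x: "\<forall>n. x n \<in> {c / 2..}" "x \<longlonglongrightarrow> l"
      show "(\<lambda>n. \<integral>s. bessel_integrand p (x n) s \<partial>lborel) \<longlonglongrightarrow> (\<integral>s. bessel_integrand p l s \<partial>lborel)"
      proof (rule integral_dominated_convergence)
        show "integrable lborel (bessel_integrand p (c / 2))"
          using c by (intro integrable_bessel_integrand) simp
        show "AE s in lborel. (\<lambda>n. bessel_integrand p (x n) s) \<longlonglongrightarrow> bessel_integrand p l s"
        proof (rule AE_I2)
          fix s :: real
          show "(\<lambda>n. bessel_integrand p (x n) s) \<longlonglongrightarrow> bessel_integrand p l s"
            by (cases "s > 0") (auto simp: bessel_integrand_def intro!: tendsto_intros x(2))
        qed
        show "AE s in lborel. norm (bessel_integrand p (x n) s) \<le> bessel_integrand p (c / 2) s" for n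
        proof (rule AE_I2)
          fix s :: real
          show "norm (bessel_integrand p (x n) s) \<le> bessel_integrand p (c / 2) s"
          proof (cases "s > 0")
            case True
            have "c / 2 / s \<le> x n / s"
              using x(1) True by (intro divide_right_mono) auto
            then show ?thesis
              using True by (simp add: bessel_integrand_def)
          qed (simp add: bessel_integrand_def)
        qed
      qed measurable
    qed
    then have "continuous_on {c / 2<..} (\<lambda>c. enn2real (bessel_nn p 1 c))"
      by (rule continuous_on_subset) auto
    then show ?thesis
      using c by (auto simp: continuous_on_eq_continuous_at)
  qed
  then show ?thesis
    by (intro continuous_at_imp_continuous_on) auto
qed

section \<open>The Gaussian mixture and its Fourier transform\<close>

definition linnik2_density :: "real \<Rightarrow> 'a::euclidean_space \<Rightarrow> real" where
  "linnik2_density \<nu> x = 1 / (Gamma \<nu> * (4 * pi) powr (real DIM('a) / 2)) *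
     enn2real (bessel_nn (\<nu> - real DIM('a) / 2) 1 ((norm x)\<^sup>2 / 4))"

definition gamma_density :: "real \<Rightarrow> real \<Rightarrow> real" where
  "gamma_density \<nu> s = indicator {0<..} s * (s powr (\<nu> - 1) * exp (- s) / Gamma \<nu>)"

lemma borel_measurable_gamma_density [measurable]: "gamma_density \<nu> \<in> borel_measurable borel"
  unfolding gamma_density_def by measurable

lemma gamma_density_nonneg: "\<nu> > 0 \<Longrightarrow> 0 \<le> gamma_density \<nu> s"
  by (simp add: gamma_density_def Gamma_real_nonneg)

text \<open>Merging the exponentials gives a Gamma integral of rate \<open>1 + u\<close>. At
  \<open>u = (norm t)\<^sup>2\<close> this is the required characteristic function; at
  \<open>u = 0\<close> it gives integrability of the mixing density.\<close>

lemma gamma_density_laplace: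
  assumes "\<nu> > 0" "u \<ge> 0"
  shows "has_bochner_integral lborel (\<lambda>s. gamma_density \<nu> s * exp (- s * u)) ((1 + u) powr (- \<nu>))"
proof -
  have "has_bochner_integral lborel (\<lambda>s. indicator {0<..} s * (s powr (\<nu> - 1) * exp (- (1 + u) * s)))
      (Gamma \<nu> * (1 + u) powr (- \<nu>))"
    using assms nn_integral_Gamma_scaled[of \<nu> "1 + u"]
    by (intro has_bochner_integral_nn_integral) (auto simp: Gamma_real_nonneg)
  from has_bochner_integral_mult_right[OF this, of "1 / Gamma \<nu>"] show ?thesis
  proof (rule has_bochner_integral_cong[THEN iffD1, rotated -1])
    show "1 / Gamma \<nu> * (indicator {0<..} s * (s powr (\<nu> - 1) * exp (- (1 + u) * s)))
        = gamma_density \<nu> s * exp (- s * u)" for s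
      by (simp add: gamma_density_def algebra_simps flip: exp_add)
    show "1 / Gamma \<nu> * (Gamma \<nu> * (1 + u) powr (- \<nu>)) = (1 + u) powr (- \<nu>)"
      using Gamma_real_pos[OF assms(1)] by simp
  qed simp
qed

lemma linnik2_density_mixture:
  assumes "\<nu> > 0"
  shows "(\<integral>s. gamma_density \<nu> s * gaussian s x \<partial>lborel) = linnik2_density \<nu> (x::'a::euclidean_space)"
proof -
  have "gamma_density \<nu> s * gaussian s x = 1 / (Gamma \<nu> * (4 * pi) powr (real DIM('a) / 2)) *
      bessel_integrand (\<nu> - real DIM('a) / 2) ((norm x)\<^sup>2 / 4) s" for s
  proof (cases "s > 0")
    case True
    have "s powr (\<nu> - real DIM('a) / 2 - 1) = s powr (\<nu> - 1) * s powr (- (real DIM('a) / 2))"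
      unfolding powr_add[symmetric] by (rule arg_cong2[where f="(powr)"]) simp_all
    moreover have "(4 * pi * s) powr (- (real DIM('a) / 2))
        = s powr (- (real DIM('a) / 2)) / (4 * pi) powr (real DIM('a) / 2)"
      using True by (subst powr_mult) (auto simp: powr_minus_divide)
    moreover have "exp (- s - (norm x)\<^sup>2 / 4 / s) = exp (- s) * exp (- (norm x)\<^sup>2 / (4 * s))"
      by (simp flip: exp_add)
    ultimately show ?thesis
      using True by (simp add: gamma_density_def bessel_integrand_def gaussian_def)
  qed (simp add: gamma_density_def bessel_integrand_def)
  then show ?thesis
    unfolding linnik2_density_def enn2real_bessel_nn by simp
qed

lemma
  fixes t :: "'a::euclidean_space"
  assumes \<nu>: "\<nu> > 0"
  shows integrable_linnik2_density: "integrable lborel (linnik2_density \<nu> :: 'a \<Rightarrow> real)"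
    and linnik2_density_fourier:
      "(CLINT x|lborel. iexp (x \<bullet> t) * complex_of_real (linnik2_density \<nu> x)) = (1 + (norm t)\<^sup>2) powr (- \<nu>)"
proof -
  define F where "F = (\<lambda>t s x :: 'a. complex_of_real (gamma_density \<nu> s) * (iexp (x \<bullet> t) * complex_of_real (gaussian s x)))"
  have norm_F: "norm (F t s x) = gamma_density \<nu> s * gaussian s x" for t s x
    using gamma_density_nonneg[OF \<nu>] by (simp add: F_def norm_mult)
  \<comment> \<open>The Gaussian formulas hold for \<open>s > 0\<close> only; elsewhere the mixing
    weight removes the integrand.\<close>
  have vanish: "gamma_density \<nu> s = 0" if "s \<le> 0" for s
    using that by (simp add: gamma_density_def)
  have int_x: "integrable lborel (F t s)" for t s
  proof (cases "s > 0")
    case True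
    then show ?thesis
      unfolding F_def by (intro integrable_mult_right gaussian_fourier)
  qed (simp add: F_def vanish)
  have norm_x: "(\<integral>x. norm (F t s x) \<partial>lborel) = gamma_density \<nu> s" for t s
    unfolding norm_F by (cases "s > 0") (auto simp: integral_gaussian vanish)
  have int: "integrable (lborel \<Otimes>\<^sub>M lborel) (\<lambda>(s, x). F t s x)" for t
  proof (rule lborel_pair.Fubini_integrable)
    show "(\<lambda>(s, x). F t s x) \<in> borel_measurable (lborel \<Otimes>\<^sub>M lborel)"
      unfolding F_def gaussian_def by measurable
    show "integrable lborel (\<lambda>s. \<integral>x. norm (case (s, x) of (s, x) \<Rightarrow> F t s x) \<partial>lborel)"
      using integrable.intros[OF gamma_density_laplace[OF \<nu>, of 0]] by (simp add: norm_x)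
    show "AE s in lborel. integrable lborel (\<lambda>x. case (s, x) of (s, x) \<Rightarrow> F t s x)"
      using int_x by simp
  qed
  have inner: "(CLINT s|lborel. F t s x) = iexp (x \<bullet> t) * complex_of_real (linnik2_density \<nu> x)" for t x
  proof -
    have "F t s x = iexp (x \<bullet> t) * complex_of_real (gamma_density \<nu> s * gaussian s x)" for s
      by (simp add: F_def)
    then show ?thesis
      by (simp only: integral_mult_right_zero integral_complex_of_real linnik2_density_mixture[OF \<nu>])
  qed
  \<comment> \<open>At \<open>t = 0\<close> the character is 1, so this marginal of \<open>F\<close>
    is the density itself.\<close>
  have "integrable lborel (\<lambda>x. CLINT s|lborel. F 0 s x)"
    by (rule lborel_pair.integrable_snd[OF int])
  then show "integrable lborel (linnik2_density \<nu> :: 'a \<Rightarrow> real)"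
    by (simp add: inner complex_of_real_integrable_eq)
  have "(CLINT x|lborel. iexp (x \<bullet> t) * complex_of_real (linnik2_density \<nu> x)) = (CLINT x|lborel. CLINT s|lborel. F t s x)"
    by (simp only: inner)
  also have "\<dots> = (CLINT s|lborel. CLINT x|lborel. F t s x)"
    by (rule lborel_pair.Fubini_integral[OF int])
  also have "\<dots> = (CLINT s|lborel. complex_of_real (gamma_density \<nu> s * exp (- s * (norm t)\<^sup>2)))"
  proof (rule Bochner_Integration.integral_cong)
    fix s :: real
    show "(CLINT x|lborel. F t s x) = complex_of_real (gamma_density \<nu> s * exp (- s * (norm t)\<^sup>2))"
      by (cases "s > 0") (simp_all add: F_def gaussian_fourier(2) vanish)
  qed simp
  also have "\<dots> = (1 + (norm t)\<^sup>2) powr (- \<nu>)"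
    using has_bochner_integral_integral_eq[OF gamma_density_laplace[OF \<nu>, of "(norm t)\<^sup>2"]]
    by (simp only: integral_complex_of_real zero_le_power2)
  finally show "(CLINT x|lborel. iexp (x \<bullet> t) * complex_of_real (linnik2_density \<nu> x)) = (1 + (norm t)\<^sup>2) powr (- \<nu>)" .
qed

lemma is_linnik_pdf_linnik2_density:
  assumes \<nu>: "\<nu> > 0"
  shows "is_linnik_pdf 2 \<nu> (linnik2_density \<nu> :: real ^ 'n::finite \<Rightarrow> real)"
proof -
  let ?p = "linnik2_density \<nu> :: real ^ 'n \<Rightarrow> real"
  have nonneg: "0 \<le> ?p x" for x
    using \<nu> by (simp add: linnik2_density_def Gamma_real_nonneg)
  have int: "integrable lborel ?p"
    by (rule integrable_linnik2_density[OF \<nu>])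
  have [measurable]: "?p \<in> borel_measurable borel"
    using borel_measurable_integrable[OF int] by simp
  have "complex_of_real (\<integral>x. ?p x \<partial>lborel) = complex_of_real 1"
    using linnik2_density_fourier[OF \<nu>, of "0 :: real ^ 'n"] by simp
  then have "(\<integral>x. ?p x \<partial>lborel) = 1"
    by (simp only: of_real_eq_iff)
  then have "(\<integral>\<^sup>+x. ennreal (?p x) \<partial>lborel) = 1"
    using nn_integral_eq_integral[OF int] nonneg by simp
  then have "prob_space (density lborel (\<lambda>x. ennreal (?p x)))"
    by (intro prob_spaceI) (simp add: emeasure_density)
  moreover have "norm t powr 2 = (norm t)\<^sup>2" for t :: "real ^ 'n"
    by simp
  \<comment> \<open>Off the origin \<open>(norm x)\<^sup>2 / 4\<close> is positive, where the Bessel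
    integral is continuous. At the origin it diverges if \<nu> is at most half the dimension, and
    \<open>enn2real\<close> then gives the value 0.\<close>
  moreover have "continuous_on (- {0}) ?p"
    unfolding linnik2_density_def
    by (intro continuous_intros continuous_on_compose2[OF continuous_on_bessel]) auto
  ultimately show ?thesis
    unfolding is_linnik_pdf_def using nonneg linnik2_density_fourier[OF \<nu>, where 'a="real ^ 'n"] by simp
qed

section \<open>Uniqueness off the origin and the radial profile\<close>

lemma is_linnik_pdf_unique:
  fixes x :: "real ^ 'n::finite"
  assumes p: "is_linnik_pdf \<alpha> \<nu> p" and q: "is_linnik_pdf \<alpha> \<nu> q" and x: "x \<noteq> 0"
  shows "p x = q x"
proof -
  have props: "integrable lborel p" "isCont p x" if p: "is_linnik_pdf \<alpha> \<nu> p" for p :: "real ^ 'n \<Rightarrow> real"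
  proof -
    have [measurable]: "p \<in> borel_measurable borel" and nonneg: "\<And>x. 0 \<le> p x"
      and prob: "prob_space (density lborel (\<lambda>x. ennreal (p x)))" and cont: "continuous_on (- {0}) p"
      using p by (auto simp: is_linnik_pdf_def)
    have "(\<integral>\<^sup>+x. ennreal (p x) \<partial>lborel) = ennreal 1"
      using prob_space.emeasure_space_1[OF prob] by (simp add: emeasure_density)
    then show "integrable lborel p"
      using nonneg by (intro integrableI_nn_integral_finite[of _ _ 1]) auto
    show "isCont p x"
      using cont x by (simp add: continuous_on_eq_continuous_at open_Compl)
  qed
  show ?thesis
    using props[OF p] props[OF q] p q
    by (intro fourier_transform_inj_continuity_point) (auto simp: is_linnik_pdf_def)
qed

lemma linnik_radial_eq_bessel:
  assumes \<nu>: "\<nu> > 0" and r: "r > 0"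
  shows "linnik_radial TYPE('n::finite) 2 \<nu> r =
    1 / (Gamma \<nu> * (4 * pi) powr (real CARD('n) / 2)) * enn2real (bessel_nn (\<nu> - real CARD('n) / 2) 1 (r\<^sup>2 / 4))"
    (is "_ = ?v")
proof -
  have pdf: "is_linnik_pdf 2 \<nu> (linnik_pdf 2 \<nu> :: real ^ 'n \<Rightarrow> real)"
    unfolding linnik_pdf_def by (rule someI[where P="is_linnik_pdf 2 \<nu>", OF is_linnik_pdf_linnik2_density[OF \<nu>]])
  have val: "linnik_pdf 2 \<nu> x = ?v" if "norm x = r" for x :: "real ^ 'n"
  proof -
    have "x \<noteq> 0" using that r by auto
    then have "linnik_pdf 2 \<nu> x = linnik2_density \<nu> x"
      by (rule is_linnik_pdf_unique[OF pdf is_linnik_pdf_linnik2_density[OF \<nu>]])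
    then show ?thesis
      using that by (simp add: linnik2_density_def)
  qed
  \<comment> \<open>A point on the sphere is needed for the description to be unique: over an empty
    sphere its condition would hold for every value.\<close>
  obtain x :: "real ^ 'n" where x: "norm x = r"
    using vector_choose_size[of r] r by auto
  show ?thesis
    unfolding linnik_radial_def
    by (rule the_equality) (use val x in auto)
qed

lemma linnik_radial_expansion:
  fixes n :: nat and \<nu> :: real
  assumes n: "n = CARD('n::finite)" and \<nu>: "\<nu> > 0"
  shows "(\<lambda>r. linnik_radial TYPE('n) 2 \<nu> r
      - exp (- r) / (2 powr ((real n - 1) / 2 + \<nu>) * pi powr ((real n - 1) / 2) * Gamma \<nu>)
        * (\<Sum>j<N. 1 / (2 ^ j * fact j) * Gamma_quotient ((real n + 1) / 2 - \<nu>) j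
             * r powr (\<nu> - (real n + 1) / 2 - real j)))
    \<in> O[at_top](\<lambda>r. r powr (\<nu> - (real n + 1) / 2 - real N) * exp (- r))"
proof -
  define a where "a = (real n + 1) / 2 - \<nu>"
  have p: "\<nu> - real CARD('n) / 2 = 1 / 2 - a"
    by (simp add: a_def n field_simps)
  have e: "\<nu> - (real n + 1) / 2 - x = - a - x" for x
    by (simp add: a_def)
  define \<kappa> where "\<kappa> = 1 / (Gamma \<nu> * (4 * pi) powr (real n / 2))"
  have \<kappa>: "\<kappa> > 0"
    using Gamma_real_pos[OF \<nu>] by (simp add: \<kappa>_def)
  define K where "K = 2 powr ((real n - 1) / 2 + \<nu>) * pi powr ((real n - 1) / 2) * Gamma \<nu>"
  \<comment> \<open>The powers of 2 match because \<open>n - a = (n - 1) / 2 + \<nu>\<close>, those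
    of \<open>pi\<close> because \<open>n / 2 - 1 / 2 = (n - 1) / 2\<close>.\<close>
  have K: "\<kappa> * (sqrt pi * 2 powr a) = 1 / K"
  proof -
    have four: "(4 * pi) powr (real n / 2) = 2 powr real n * pi powr (real n / 2)"
    proof -
      have "4 powr (real n / 2) = (2 powr 2) powr (real n / 2)"
        by simp
      also have "\<dots> = 2 powr real n"
        by (subst powr_powr) simp
      finally show ?thesis
        by (simp add: powr_mult)
    qed
    have two: "2 powr a * 2 powr ((real n - 1) / 2 + \<nu>) = 2 powr real n"
      unfolding powr_add[symmetric] by (rule arg_cong2[where f="(powr)"]) (simp_all add: a_def field_simps)
    have root: "sqrt pi * pi powr ((real n - 1) / 2) = pi powr (real n / 2)"
      unfolding powr_half_sqrt[OF pi_ge_zero, symmetric] powr_add[symmetric]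
      by (rule arg_cong2[where f="(powr)"]) (simp_all add: field_simps)
    have "(4 * pi) powr (real n / 2) = (2 powr a * 2 powr ((real n - 1) / 2 + \<nu>)) * (sqrt pi * pi powr ((real n - 1) / 2))"
      by (simp only: four two root)
    then have "(4 * pi) powr (real n / 2) = sqrt pi * 2 powr a * (2 powr ((real n - 1) / 2 + \<nu>) * pi powr ((real n - 1) / 2))"
      by (simp only: mult_ac)
    then show ?thesis
      using Gamma_real_pos[OF \<nu>] by (simp add: \<kappa>_def K_def)
  qed
  let ?S = "\<lambda>r. \<Sum>j<N. 1 / (2 ^ j * fact j) * Gamma_quotient a j * r powr (- a - real j)"
  obtain C where C: "\<And>r. r \<ge> 1 \<Longrightarrow>
    \<bar>enn2real (bessel_nn (1 / 2 - a) 1 (r\<^sup>2 / 4)) - sqrt pi * 2 powr a * exp (- r) * ?S r\<bar>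
    \<le> C * (r powr (- a - real N) * exp (- r))"
    using bessel_nn_expansion by blast
  have "\<bar>linnik_radial TYPE('n) 2 \<nu> r - exp (- r) / K * ?S r\<bar> \<le> \<kappa> * C * (r powr (- a - real N) * exp (- r))"
    if r: "r \<ge> 1" for r
  proof -
    have "linnik_radial TYPE('n) 2 \<nu> r = \<kappa> * enn2real (bessel_nn (1 / 2 - a) 1 (r\<^sup>2 / 4))"
      using linnik_radial_eq_bessel[OF \<nu>, of r, where 'n='n] r unfolding p by (simp add: \<kappa>_def n)
    moreover have "exp (- r) / K * ?S r = \<kappa> * (sqrt pi * 2 powr a * exp (- r) * ?S r)"
    proof -
      have "exp (- r) / K * ?S r = (1 / K) * (exp (- r) * ?S r)"
        by simp
      then show ?thesis
        unfolding K[symmetric] by (simp only: mult_ac)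
    qed
    ultimately have "\<bar>linnik_radial TYPE('n) 2 \<nu> r - exp (- r) / K * ?S r\<bar>
        = \<kappa> * \<bar>enn2real (bessel_nn (1 / 2 - a) 1 (r\<^sup>2 / 4)) - sqrt pi * 2 powr a * exp (- r) * ?S r\<bar>"
      using \<kappa> by (simp only: right_diff_distrib[symmetric] abs_mult abs_of_pos)
    also have "\<dots> \<le> \<kappa> * (C * (r powr (- a - real N) * exp (- r)))"
      using C[OF r] \<kappa> by (intro mult_left_mono) auto
    finally show ?thesis
      by (simp only: mult.assoc)
  qed
  then have "(\<lambda>r. linnik_radial TYPE('n) 2 \<nu> r - exp (- r) / K * ?S r) \<in> O[at_top](\<lambda>r. r powr (- a - real N) * exp (- r))"
    by (intro bigoI[of _ "\<kappa> * C"] eventually_at_top_linorderI[of 1]) (simp add: abs_mult)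
  then show ?thesis
    unfolding e K_def a_def[symmetric] .
qed

theorem proposition3p1:
  fixes n :: nat and \<nu> :: real
  assumes "n = CARD('n::finite)" and "\<nu> > 0"
  shows "(\<forall>N::nat. N \<ge> 1 \<longrightarrow>
            (\<lambda>r. linnik_radial TYPE('n) 2 \<nu> r
                 - exp (- r) / (2 powr ((real n - 1) / 2 + \<nu>) * pi powr ((real n - 1) / 2) * Gamma \<nu>)
                   * (\<Sum>j = 0..N - 1. 1 / (2 ^ j * fact j)
                        * Gamma_quotient ((real n + 1) / 2 - \<nu>) j
                        * r powr (\<nu> - (real n + 1) / 2 - real j)))
            \<in> O[at_top](\<lambda>r. r powr (\<nu> - (real n + 1) / 2 - real N) * exp (- r)))
       \<and> (\<lambda>r. linnik_radial TYPE('n) 2 \<nu> r) \<sim>[at_top]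
           (\<lambda>r. r powr (\<nu> - (real n + 1) / 2) * exp (- r)
                / (2 powr ((real n - 1) / 2 + \<nu>) * pi powr ((real n - 1) / 2) * Gamma \<nu>))"
proof (intro conjI allI impI)
  fix N :: nat assume "N \<ge> 1"
  \<comment> \<open>Here \<open>N \<ge> 1\<close> matters: with truncated subtraction,
    \<open>{0..N - 1}\<close> would contain 0 for \<open>N = 0\<close>.\<close>
  then have "{0..N - 1} = {..<N}"
    by auto
  then show "(\<lambda>r. linnik_radial TYPE('n) 2 \<nu> r
                 - exp (- r) / (2 powr ((real n - 1) / 2 + \<nu>) * pi powr ((real n - 1) / 2) * Gamma \<nu>)
                   * (\<Sum>j = 0..N - 1. 1 / (2 ^ j * fact j)
                        * Gamma_quotient ((real n + 1) / 2 - \<nu>) j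
                        * r powr (\<nu> - (real n + 1) / 2 - real j)))
            \<in> O[at_top](\<lambda>r. r powr (\<nu> - (real n + 1) / 2 - real N) * exp (- r))"
    by (simp only: linnik_radial_expansion[OF assms])
next
  define K where "K = 2 powr ((real n - 1) / 2 + \<nu>) * pi powr ((real n - 1) / 2) * Gamma \<nu>"
  define b where "b = \<nu> - (real n + 1) / 2"
  have K: "K > 0"
    using Gamma_real_pos[OF assms(2)] by (simp add: K_def)
  \<comment> \<open>The case \<open>N = 1\<close>, where the only coefficient is 1. The error scale
    divided by the leading term is \<open>K / r\<close>, which tends to 0.\<close>
  have "(\<lambda>r. linnik_radial TYPE('n) 2 \<nu> r - r powr b * exp (- r) / K) \<in> O[at_top](\<lambda>r. r powr (b - 1) * exp (- r))"
    using linnik_radial_expansion[OF assms, of 1] by (simp add: K_def b_def mult.commute)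
  also have "(\<lambda>r. r powr (b - 1) * exp (- r)) \<in> o[at_top](\<lambda>r. r powr b * exp (- r) / K)"
  proof (rule smalloI_tendsto)
    have "((\<lambda>r::real. K * inverse r) \<longlongrightarrow> K * 0) at_top"
      by (intro tendsto_intros tendsto_inverse_0_at_top filterlim_ident)
    moreover have "eventually (\<lambda>r. K * inverse r = r powr (b - 1) * exp (- r) / (r powr b * exp (- r) / K)) at_top"
      using eventually_gt_at_top[of 0] by eventually_elim (simp add: powr_diff field_simps)
    ultimately show "((\<lambda>r. r powr (b - 1) * exp (- r) / (r powr b * exp (- r) / K)) \<longlongrightarrow> 0) at_top"
      by (simp cong: filterlim_cong)
    show "eventually (\<lambda>r. r powr b * exp (- r) / K \<noteq> 0) at_top"
      using eventually_gt_at_top[of 0] by eventually_elim (use K in simp)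
  qed
  finally have "(\<lambda>r. linnik_radial TYPE('n) 2 \<nu> r) \<sim>[at_top] (\<lambda>r. r powr b * exp (- r) / K)"
    by (rule smallo_imp_asymp_equiv)
  then show "(\<lambda>r. linnik_radial TYPE('n) 2 \<nu> r) \<sim>[at_top]
           (\<lambda>r. r powr (\<nu> - (real n + 1) / 2) * exp (- r)
                / (2 powr ((real n - 1) / 2 + \<nu>) * pi powr ((real n - 1) / 2) * Gamma \<nu>))"
    unfolding K_def b_def .
qed

end
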